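(* Let $\mathfrak g$ be a profinite-dimensional $\mathbb K$-Lie algebra, and for $J\subseteq I$ in $\mathcal I(\mathfrak g)$ let $p_I\colon\mathfrak g\to\mathfrak g/I$ and $p_{IJ}\colon\mathfrak g/J\to\mathfrak g/I$ be the quotient morphisms. Then $\{\mathbf U(\mathfrak g/I),\mathbf U(p_{IJ})\}$ is an inverse system of weakly complete unital algebras, and the natural morphism $\omega_{\mathfrak g}\colon\mathbf U(\mathfrak g)\to\lim_{I\in\mathcal I(\mathfrak g)}\mathbf U(\mathfrak g/I)$, whose composition with the limit projection onto $\mathbf U(\mathfrak g/I)$ is $\mathbf U(p_I)$ for every $I$, is an isomorphism of weakly complete unital algebras. In short, $\mathbf U(\lim_{I}\mathfrak g/I)=\mathbf U(\mathfrak g)\cong\lim_{I}\mathbf U(\mathfrak g/I)$.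
   Context: $\mathbb K\in\{\mathbb R,\mathbb C\}$. A topological $\mathbb K$-vector space is weakly complete if it is isomorphic to a power $\mathbb K^J$ (with the product topology) for some set $J$. A weakly complete unital algebra is a unital associative $\mathbb K$-algebra $A$ carrying a topology that makes it a weakly complete vector space and makes multiplication continuous; morphisms are continuous unital algebra homomorphisms. For such $A$, $[A]$ denotes the topological Lie algebra with the same underlying topological vector space and bracket $[x,y]=xy-yx$. For a topological $\mathbb K$-Lie algebra $\mathfrak g$ let $\mathcal I(\mathfrak g)$ be the set of closed ideals $I$ of $\mathfrak g$ with $\dim \mathfrak g/I<\infty$; $\mathfrak g$ is profinite-dimensional if the natural map $\mathfrak g\to\lim_{I\in\mathcal I(\mathfrak g)}\mathfrak g/I$ is an isomorphism of topological Lie algebras. The weakly complete enveloping algebra of a profinite-dimensional Lie algebra $\mathfrak g$ is a weakly complete unital algebra $\mathbf U(\mathfrak g)$ together with a continuous Lie algebra morphism $\lambda_{\mathfrak g}\colon\mathfrak g\to[\mathbf U(\mathfrak g)]$ such that for every weakly complete unital algebra $A$ and every continuous Lie algebra morphism $f\colon\mathfrak g\to[A]$ there is a unique continuous unital algebra morphism $f'\colon\mathbf U(\mathfrak g)\to A$ with $f=f'\circ\lambda_{\mathfrak g}$; $\mathbf U$ is a functor (left adjoint to $A\mapsto[A]$). *)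

theory Defs
  imports "HOL-Analysis.Analysis"
begin

text \<open>The scalar field K is a type 'k of class real_normed_field (by Mazur's theorem
these are exactly R and C up to isomorphism) with its Euclidean (norm) topology.\<close>

record ('a, 'k) tvs =
  vcar  :: "'a set"
  vadd  :: "'a \<Rightarrow> 'a \<Rightarrow> 'a"
  vzero :: "'a"
  vsmul :: "'k \<Rightarrow> 'a \<Rightarrow> 'a"
  vtop  :: "'a topology"

record ('a, 'k) alg = "('a, 'k) tvs" +
  amul :: "'a \<Rightarrow> 'a \<Rightarrow> 'a"
  aone :: "'a"

record ('a, 'k) lie = "('a, 'k) tvs" +
  lbr :: "'a \<Rightarrow> 'a \<Rightarrow> 'a"

definition vsub :: "('a, 'k::real_normed_field, 'z) tvs_scheme \<Rightarrow> 'a \<Rightarrow> 'a \<Rightarrow> 'a" where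
  "vsub V x y = vadd V x (vsmul V (-1) y)"

fun lincomb :: "('a, 'k::real_normed_field, 'z) tvs_scheme \<Rightarrow> ('k \<times> 'a) list \<Rightarrow> 'a" where
  "lincomb V [] = vzero V"
| "lincomb V (p # ps) = vadd V (vsmul V (fst p) (snd p)) (lincomb V ps)"

definition vs :: "('a, 'k::real_normed_field, 'z) tvs_scheme \<Rightarrow> bool" where
  "vs V \<longleftrightarrow>
     vzero V \<in> vcar V \<and>
     (\<forall>x\<in>vcar V. \<forall>y\<in>vcar V. vadd V x y \<in> vcar V) \<and>
     (\<forall>c. \<forall>x\<in>vcar V. vsmul V c x \<in> vcar V) \<and>
     (\<forall>x\<in>vcar V. \<forall>y\<in>vcar V. \<forall>z\<in>vcar V. vadd V (vadd V x y) z = vadd V x (vadd V y z)) \<and>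
     (\<forall>x\<in>vcar V. \<forall>y\<in>vcar V. vadd V x y = vadd V y x) \<and>
     (\<forall>x\<in>vcar V. vadd V (vzero V) x = x) \<and>
     (\<forall>x\<in>vcar V. \<exists>y\<in>vcar V. vadd V x y = vzero V) \<and>
     (\<forall>c. \<forall>x\<in>vcar V. \<forall>y\<in>vcar V. vsmul V c (vadd V x y) = vadd V (vsmul V c x) (vsmul V c y)) \<and>
     (\<forall>c d. \<forall>x\<in>vcar V. vsmul V (c + d) x = vadd V (vsmul V c x) (vsmul V d x)) \<and>
     (\<forall>c d. \<forall>x\<in>vcar V. vsmul V (c * d) x = vsmul V c (vsmul V d x)) \<and>
     (\<forall>x\<in>vcar V. vsmul V 1 x = x)"

definition tvs :: "('a, 'k::real_normed_field, 'z) tvs_scheme \<Rightarrow> bool" where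
  "tvs V \<longleftrightarrow> vs V \<and> topspace (vtop V) = vcar V \<and>
     continuous_map (prod_topology (vtop V) (vtop V)) (vtop V) (\<lambda>(x, y). vadd V x y) \<and>
     continuous_map (prod_topology (euclidean :: 'k topology) (vtop V)) (vtop V) (\<lambda>(c, x). vsmul V c x)"

definition linmap :: "('a, 'k::real_normed_field, 'z) tvs_scheme \<Rightarrow> ('b, 'k, 'w) tvs_scheme \<Rightarrow> ('a \<Rightarrow> 'b) \<Rightarrow> bool" where
  "linmap V W f \<longleftrightarrow> (\<forall>x\<in>vcar V. f x \<in> vcar W) \<and>
     (\<forall>x\<in>vcar V. \<forall>y\<in>vcar V. f (vadd V x y) = vadd W (f x) (f y)) \<and>
     (\<forall>c. \<forall>x\<in>vcar V. f (vsmul V c x) = vsmul W c (f x))"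

text \<open>Weakly complete: isomorphic (as topological vector space) to a power K^J with the
product topology. The index set J may be taken inside the carrier type, since |J| < |K^J|.\<close>

definition wcs :: "('a, 'k::real_normed_field, 'z) tvs_scheme \<Rightarrow> bool" where
  "wcs V \<longleftrightarrow> tvs V \<and>
     (\<exists>(J :: 'a set) (f :: 'a \<Rightarrow> 'a \<Rightarrow> 'k).
        homeomorphic_map (vtop V) (product_topology (\<lambda>_. (euclidean :: 'k topology)) J) f \<and>
        (\<forall>x\<in>vcar V. \<forall>y\<in>vcar V. f (vadd V x y) = (\<lambda>j\<in>J. f x j + f y j)) \<and>
        (\<forall>c. \<forall>x\<in>vcar V. f (vsmul V c x) = (\<lambda>j\<in>J. c * f x j)))"

definition wc_alg :: "('a, 'k::real_normed_field) alg \<Rightarrow> bool" where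
  "wc_alg A \<longleftrightarrow> wcs A \<and> aone A \<in> vcar A \<and>
     (\<forall>x\<in>vcar A. \<forall>y\<in>vcar A. amul A x y \<in> vcar A) \<and>
     (\<forall>x\<in>vcar A. \<forall>y\<in>vcar A. \<forall>z\<in>vcar A. amul A (amul A x y) z = amul A x (amul A y z)) \<and>
     (\<forall>x\<in>vcar A. amul A (aone A) x = x \<and> amul A x (aone A) = x) \<and>
     (\<forall>x\<in>vcar A. \<forall>y\<in>vcar A. \<forall>z\<in>vcar A.
        amul A (vadd A x y) z = vadd A (amul A x z) (amul A y z) \<and>
        amul A z (vadd A x y) = vadd A (amul A z x) (amul A z y)) \<and>
     (\<forall>c. \<forall>x\<in>vcar A. \<forall>y\<in>vcar A.
        amul A (vsmul A c x) y = vsmul A c (amul A x y) \<and>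
        amul A x (vsmul A c y) = vsmul A c (amul A x y)) \<and>
     continuous_map (prod_topology (vtop A) (vtop A)) (vtop A) (\<lambda>(x, y). amul A x y)"

definition alg_hom :: "('a, 'k::real_normed_field) alg \<Rightarrow> ('b, 'k) alg \<Rightarrow> ('a \<Rightarrow> 'b) \<Rightarrow> bool" where
  "alg_hom A B f \<longleftrightarrow> linmap A B f \<and> continuous_map (vtop A) (vtop B) f \<and>
     (\<forall>x\<in>vcar A. \<forall>y\<in>vcar A. f (amul A x y) = amul B (f x) (f y)) \<and> f (aone A) = aone B"

definition alg_iso :: "('a, 'k::real_normed_field) alg \<Rightarrow> ('b, 'k) alg \<Rightarrow> ('a \<Rightarrow> 'b) \<Rightarrow> bool" where
  "alg_iso A B f \<longleftrightarrow> alg_hom A B f \<and>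
     (\<exists>g. alg_hom B A g \<and> (\<forall>x\<in>vcar A. g (f x) = x) \<and> (\<forall>y\<in>vcar B. f (g y) = y))"

definition top_lie :: "('a, 'k::real_normed_field) lie \<Rightarrow> bool" where
  "top_lie L \<longleftrightarrow> tvs L \<and>
     (\<forall>x\<in>vcar L. \<forall>y\<in>vcar L. lbr L x y \<in> vcar L) \<and>
     (\<forall>x\<in>vcar L. \<forall>y\<in>vcar L. \<forall>z\<in>vcar L.
        lbr L (vadd L x y) z = vadd L (lbr L x z) (lbr L y z) \<and>
        lbr L z (vadd L x y) = vadd L (lbr L z x) (lbr L z y)) \<and>
     (\<forall>c. \<forall>x\<in>vcar L. \<forall>y\<in>vcar L.
        lbr L (vsmul L c x) y = vsmul L c (lbr L x y) \<and>
        lbr L x (vsmul L c y) = vsmul L c (lbr L x y)) \<and>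
     (\<forall>x\<in>vcar L. lbr L x x = vzero L) \<and>
     (\<forall>x\<in>vcar L. \<forall>y\<in>vcar L. \<forall>z\<in>vcar L.
        vadd L (vadd L (lbr L x (lbr L y z)) (lbr L y (lbr L z x))) (lbr L z (lbr L x y)) = vzero L) \<and>
     continuous_map (prod_topology (vtop L) (vtop L)) (vtop L) (\<lambda>(x, y). lbr L x y)"

definition lie_hom :: "('a, 'k::real_normed_field) lie \<Rightarrow> ('b, 'k) lie \<Rightarrow> ('a \<Rightarrow> 'b) \<Rightarrow> bool" where
  "lie_hom L M f \<longleftrightarrow> linmap L M f \<and> continuous_map (vtop L) (vtop M) f \<and>
     (\<forall>x\<in>vcar L. \<forall>y\<in>vcar L. f (lbr L x y) = lbr M (f x) (f y))"

definition lie_iso :: "('a, 'k::real_normed_field) lie \<Rightarrow> ('b, 'k) lie \<Rightarrow> ('a \<Rightarrow> 'b) \<Rightarrow> bool" where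
  "lie_iso L M f \<longleftrightarrow> lie_hom L M f \<and>
     (\<exists>g. lie_hom M L g \<and> (\<forall>x\<in>vcar L. g (f x) = x) \<and> (\<forall>y\<in>vcar M. f (g y) = y))"

definition comm_lie :: "('a, 'k::real_normed_field) alg \<Rightarrow> ('a, 'k) lie" where
  "comm_lie A = \<lparr> vcar = vcar A, vadd = vadd A, vzero = vzero A, vsmul = vsmul A, vtop = vtop A,
     lbr = (\<lambda>x y. vsub A (amul A x y) (amul A y x)) \<rparr>"

definition fin_codim :: "('a, 'k::real_normed_field) lie \<Rightarrow> 'a set \<Rightarrow> bool" where
  "fin_codim L I \<longleftrightarrow> (\<exists>ws. set ws \<subseteq> vcar L \<and>
     (\<forall>x\<in>vcar L. \<exists>cs::'k list. length cs = length ws \<and> vsub L x (lincomb L (zip cs ws)) \<in> I))"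

definition closed_ideal :: "('a, 'k::real_normed_field) lie \<Rightarrow> 'a set \<Rightarrow> bool" where
  "closed_ideal L I \<longleftrightarrow> I \<subseteq> vcar L \<and> vzero L \<in> I \<and>
     (\<forall>x\<in>I. \<forall>y\<in>I. vadd L x y \<in> I) \<and> (\<forall>c. \<forall>x\<in>I. vsmul L c x \<in> I) \<and>
     (\<forall>x\<in>vcar L. \<forall>i\<in>I. lbr L x i \<in> I) \<and> closedin (vtop L) I"

definition Ideals :: "('a, 'k::real_normed_field) lie \<Rightarrow> 'a set set" where
  "Ideals L = {I. closed_ideal L I \<and> fin_codim L I}"

definition coset :: "('a, 'k::real_normed_field) lie \<Rightarrow> 'a set \<Rightarrow> 'a \<Rightarrow> 'a set" where
  "coset L I x = {y \<in> vcar L. vsub L y x \<in> I}"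

definition rep :: "'a set \<Rightarrow> 'a" where
  "rep X = (SOME x. x \<in> X)"

definition quot_top :: "('a, 'k::real_normed_field) lie \<Rightarrow> 'a set \<Rightarrow> 'a set topology" where
  "quot_top L I = topology (\<lambda>U. U \<subseteq> coset L I ` vcar L \<and> openin (vtop L) (\<Union>U))"

definition quot :: "('a, 'k::real_normed_field) lie \<Rightarrow> 'a set \<Rightarrow> ('a set, 'k) lie" where
  "quot L I = \<lparr> vcar = coset L I ` vcar L,
     vadd = (\<lambda>X Y. coset L I (vadd L (rep X) (rep Y))),
     vzero = coset L I (vzero L),
     vsmul = (\<lambda>c X. coset L I (vsmul L c (rep X))),
     vtop = quot_top L I,
     lbr = (\<lambda>X Y. coset L I (lbr L (rep X) (rep Y))) \<rparr>"

definition proj :: "('a, 'k::real_normed_field) lie \<Rightarrow> 'a set \<Rightarrow> 'a \<Rightarrow> 'a set" where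
  "proj L I x = coset L I x"

definition projIJ :: "('a, 'k::real_normed_field) lie \<Rightarrow> 'a set \<Rightarrow> 'a set \<Rightarrow> 'a set" where
  "projIJ L I X = coset L I (rep X)"

definition lim_quot :: "('a, 'k::real_normed_field) lie \<Rightarrow> ('a set \<Rightarrow> 'a set, 'k) lie" where
  "lim_quot L = (let C = {\<phi> \<in> (\<Pi>\<^sub>E I\<in>Ideals L. vcar (quot L I)).
                     \<forall>I\<in>Ideals L. \<forall>J\<in>Ideals L. J \<subseteq> I \<longrightarrow> projIJ L I (\<phi> J) = \<phi> I} in
     \<lparr> vcar = C,
       vadd = (\<lambda>\<phi> \<psi>. \<lambda>I\<in>Ideals L. vadd (quot L I) (\<phi> I) (\<psi> I)),
       vzero = (\<lambda>I\<in>Ideals L. vzero (quot L I)),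
       vsmul = (\<lambda>c \<phi>. \<lambda>I\<in>Ideals L. vsmul (quot L I) c (\<phi> I)),
       vtop = subtopology (product_topology (\<lambda>I. vtop (quot L I)) (Ideals L)) C,
       lbr = (\<lambda>\<phi> \<psi>. \<lambda>I\<in>Ideals L. lbr (quot L I) (\<phi> I) (\<psi> I)) \<rparr>)"

definition profinite :: "('a, 'k::real_normed_field) lie \<Rightarrow> bool" where
  "profinite L \<longleftrightarrow> top_lie L \<and> lie_iso L (lim_quot L) (\<lambda>x. \<lambda>I\<in>Ideals L. proj L I x)"

definition lim_alg :: "'i set \<Rightarrow> ('i \<Rightarrow> 'i \<Rightarrow> bool) \<Rightarrow> ('i \<Rightarrow> ('u, 'k::real_normed_field) alg)
    \<Rightarrow> ('i \<Rightarrow> 'i \<Rightarrow> 'u \<Rightarrow> 'u) \<Rightarrow> ('i \<Rightarrow> 'u, 'k) alg" where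
  "lim_alg Idx le A tr = (let C = {\<phi> \<in> (\<Pi>\<^sub>E i\<in>Idx. vcar (A i)).
                     \<forall>i\<in>Idx. \<forall>j\<in>Idx. le j i \<longrightarrow> tr i j (\<phi> j) = \<phi> i} in
     \<lparr> vcar = C,
       vadd = (\<lambda>\<phi> \<psi>. \<lambda>i\<in>Idx. vadd (A i) (\<phi> i) (\<psi> i)),
       vzero = (\<lambda>i\<in>Idx. vzero (A i)),
       vsmul = (\<lambda>c \<phi>. \<lambda>i\<in>Idx. vsmul (A i) c (\<phi> i)),
       vtop = subtopology (product_topology (\<lambda>i. vtop (A i)) Idx) C,
       amul = (\<lambda>\<phi> \<psi>. \<lambda>i\<in>Idx. amul (A i) (\<phi> i) (\<psi> i)),
       aone = (\<lambda>i\<in>Idx. aone (A i)) \<rparr>)"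

text \<open>(U, lam) is a weakly complete enveloping algebra of L: universal among continuous Lie
morphisms from L into [A] for weakly complete unital algebras A (carried by the type of U).\<close>

definition WCE :: "('a, 'k::real_normed_field) lie \<Rightarrow> ('u, 'k) alg \<Rightarrow> ('a \<Rightarrow> 'u) \<Rightarrow> bool" where
  "WCE L U lam \<longleftrightarrow> wc_alg U \<and> lie_hom L (comm_lie U) lam \<and>
     (\<forall>(A :: ('u, 'k) alg) f. wc_alg A \<and> lie_hom L (comm_lie A) f \<longrightarrow>
        (\<exists>h. alg_hom U A h \<and> (\<forall>x\<in>vcar L. h (lam x) = f x) \<and>
             (\<forall>h'. alg_hom U A h' \<and> (\<forall>x\<in>vcar L. h' (lam x) = f x) \<longrightarrow> (\<forall>u\<in>vcar U. h' u = h u))))"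

definition Umap :: "('a, 'k::real_normed_field) lie \<Rightarrow> ('u, 'k) alg \<Rightarrow> ('a \<Rightarrow> 'u)
    \<Rightarrow> ('v, 'k) alg \<Rightarrow> ('b \<Rightarrow> 'v) \<Rightarrow> ('a \<Rightarrow> 'b) \<Rightarrow> ('u \<Rightarrow> 'v)" where
  "Umap L U lam V mu f = (SOME h. alg_hom U V h \<and> (\<forall>x\<in>vcar L. h (lam x) = mu (f x)))"

end

theory Submission
  imports Defs
begin

text \<open>Let \<open>A \<cong> K\<^sup>J\<close> be a weakly complete algebra. Continuity of the triple product at zero
shows that a coordinate of \<open>axb\<close> depends on only finitely many coordinates of \<open>a\<close> and \<open>b\<close>. Hence
the \<open>x\<close> for which finitely many prescribed coordinates of all \<open>axb\<close> vanish form a closed two-sided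
ideal of finite codimension, so \<open>A\<close> has enough finite-dimensional quotient algebras.

A coordinate of \<open>U(g)\<close> thus factors through a finite-dimensional quotient \<open>Q\<close>; the kernel \<open>I\<close> of
\<open>g \<rightarrow> [Q]\<close> lies in \<open>I(g)\<close>, and the universal properties factor the coordinate through \<open>U(g/I)\<close>.
These factorizations assemble to a continuous left inverse of \<open>\<omega>\<close>. The universal property applied
to subalgebras of finite-dimensional quotients shows that \<open>U(g)\<close> has dense image in each
\<open>U(g/I)\<close>, hence, the system being directed, in the limit; so the left inverse is an inverse.\<close>

section \<open>Vector spaces and linear functionals\<close>

text \<open>Two restrictions shape the argument. \<open>WCE\<close> tests \<open>U\<close> only
  against algebras carried by the type of \<open>U\<close> itself, so a quotient of \<open>U\<close>
  cannot be a set of cosets and is realised on chosen representatives. The limit consists of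
  functions, hence has another carrier type, and the universal property cannot be applied to it
  directly. Therefore the inverse of \<omega> is assembled from coordinates: they identify
  \<open>U\<close> with all of K^J, so choosing, for each coordinate, one continuous function on
  some U(g/I) already defines a map from the limit to \<open>U\<close>. Nothing makes this map
  linear or multiplicative at first. Both properties, and the weak completeness of the limit, follow
  once it is known to be a continuous two-sided inverse of \<omega>.\<close>

locale vspace =
  fixes V :: "('a, 'k::real_normed_field, 'z) tvs_scheme"
  assumes vs: "vs V"
begin

lemma zero_closed [simp]: "vzero V \<in> vcar V"
  and add_closed [simp]: "x \<in> vcar V \<Longrightarrow> y \<in> vcar V \<Longrightarrow> vadd V x y \<in> vcar V"
  and smul_closed [simp]: "x \<in> vcar V \<Longrightarrow> vsmul V c x \<in> vcar V"
  and add_assoc: "x \<in> vcar V \<Longrightarrow> y \<in> vcar V \<Longrightarrow> z \<in> vcar V \<Longrightarrow>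
        vadd V (vadd V x y) z = vadd V x (vadd V y z)"
  and add_commute: "x \<in> vcar V \<Longrightarrow> y \<in> vcar V \<Longrightarrow> vadd V x y = vadd V y x"
  and add_zero_left [simp]: "x \<in> vcar V \<Longrightarrow> vadd V (vzero V) x = x"
  and smul_add: "x \<in> vcar V \<Longrightarrow> y \<in> vcar V \<Longrightarrow>
        vsmul V c (vadd V x y) = vadd V (vsmul V c x) (vsmul V c y)"
  and add_smul: "x \<in> vcar V \<Longrightarrow> vsmul V (c + d) x = vadd V (vsmul V c x) (vsmul V d x)"
  and smul_smul: "x \<in> vcar V \<Longrightarrow> vsmul V c (vsmul V d x) = vsmul V (c * d) x"
  and smul_one [simp]: "x \<in> vcar V \<Longrightarrow> vsmul V 1 x = x"
  using vs unfolding vs_def by (blast | metis)+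

lemma inverse_exists: "x \<in> vcar V \<Longrightarrow> \<exists>y\<in>vcar V. vadd V x y = vzero V"
  using vs unfolding vs_def by blast

lemma add_zero_right [simp]: "x \<in> vcar V \<Longrightarrow> vadd V x (vzero V) = x"
  using add_commute[of x "vzero V"] by simp

lemma add_left_commute:
  "x \<in> vcar V \<Longrightarrow> y \<in> vcar V \<Longrightarrow> z \<in> vcar V \<Longrightarrow> vadd V x (vadd V y z) = vadd V y (vadd V x z)"
  using add_assoc[of x y z] add_assoc[of y x z] add_commute[of x y] by simp

lemmas add_ac = add_assoc add_commute add_left_commute

lemma add_idem_zero:
  assumes "x \<in> vcar V" "vadd V x x = x"
  shows "x = vzero V"
proof -
  obtain y where y: "y \<in> vcar V" "vadd V x y = vzero V" using inverse_exists assms(1) by blast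
  have "vadd V (vadd V x x) y = vadd V x (vadd V x y)" using add_assoc assms(1) y(1) by blast
  then show ?thesis using assms y by simp
qed

lemma smul_zero_left [simp]: "x \<in> vcar V \<Longrightarrow> vsmul V 0 x = vzero V"
  using add_idem_zero[of "vsmul V 0 x"] add_smul[of x 0 0] by simp

lemma smul_zero_right [simp]: "vsmul V c (vzero V) = vzero V"
  using add_idem_zero[of "vsmul V c (vzero V)"] smul_add[of "vzero V" "vzero V" c] by simp

lemma add_smul_cancel: "x \<in> vcar V \<Longrightarrow> c + d = 0 \<Longrightarrow> vadd V (vsmul V c x) (vsmul V d x) = vzero V"
  using add_smul[of x c d] by simp

lemma sub_closed [simp]: "x \<in> vcar V \<Longrightarrow> y \<in> vcar V \<Longrightarrow> vsub V x y \<in> vcar V"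
  by (simp add: vsub_def)

lemma sub_self [simp]: "x \<in> vcar V \<Longrightarrow> vsub V x x = vzero V"
  using add_smul_cancel[of x 1 "-1"] by (simp add: vsub_def)

lemma sub_zero_right [simp]: "x \<in> vcar V \<Longrightarrow> vsub V x (vzero V) = x"
  by (simp add: vsub_def)

lemma sub_add_cancel:
  "x \<in> vcar V \<Longrightarrow> y \<in> vcar V \<Longrightarrow> vadd V (vsub V x y) y = x"
  using sub_self[of y] add_commute[of y "vsmul V (-1) y"] by (simp add: vsub_def add_assoc)

lemma add_sub_cancel:
  "x \<in> vcar V \<Longrightarrow> y \<in> vcar V \<Longrightarrow> vsub V (vadd V x y) y = x"
  using sub_self[of y] by (simp add: vsub_def add_assoc)

lemma sub_eq_zeroD: "x \<in> vcar V \<Longrightarrow> y \<in> vcar V \<Longrightarrow> vsub V x y = vzero V \<Longrightarrow> x = y"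
  using sub_add_cancel[of x y] by simp

lemma sub_add_sub:
  assumes "x \<in> vcar V" "y \<in> vcar V" "z \<in> vcar V"
  shows "vadd V (vsub V x y) (vsub V y z) = vsub V x z"
proof -
  have "vadd V (vsub V x y) (vsub V y z) = vadd V (vadd V (vsub V x y) y) (vsmul V (-1) z)"
    using assms by (simp add: vsub_def add_assoc)
  then show ?thesis using assms by (simp add: sub_add_cancel) (simp add: vsub_def)
qed

lemma sub_swap:
  "x \<in> vcar V \<Longrightarrow> y \<in> vcar V \<Longrightarrow> vsmul V (-1) (vsub V x y) = vsub V y x"
  by (simp add: vsub_def smul_add smul_smul add_commute)

lemma sub_add_distrib:
  "x \<in> vcar V \<Longrightarrow> y \<in> vcar V \<Longrightarrow> z \<in> vcar V \<Longrightarrow> w \<in> vcar V \<Longrightarrow>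
   vsub V (vadd V x y) (vadd V z w) = vadd V (vsub V x z) (vsub V y w)"
  by (simp add: vsub_def smul_add add_ac)

lemma smul_sub_distrib:
  "x \<in> vcar V \<Longrightarrow> y \<in> vcar V \<Longrightarrow> vsmul V c (vsub V x y) = vsub V (vsmul V c x) (vsmul V c y)"
  by (simp add: vsub_def smul_add smul_smul)

lemma sub_sub:
  "x \<in> vcar V \<Longrightarrow> y \<in> vcar V \<Longrightarrow> z \<in> vcar V \<Longrightarrow> vsub V x (vadd V y z) = vsub V (vsub V x y) z"
  by (simp add: vsub_def smul_add add_assoc)

lemma lincomb_closed: "snd ` set ps \<subseteq> vcar V \<Longrightarrow> lincomb V ps \<in> vcar V"
  by (induction ps) auto

end

section \<open>Linear functionals and biorthogonal systems\<close>

definition linfun :: "('a, 'k::real_normed_field, 'z) tvs_scheme \<Rightarrow> ('a \<Rightarrow> 'k) \<Rightarrow> bool" where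
  "linfun V l \<longleftrightarrow> (\<forall>x\<in>vcar V. \<forall>y\<in>vcar V. l (vadd V x y) = l x + l y) \<and>
     (\<forall>c. \<forall>x\<in>vcar V. l (vsmul V c x) = c * l x)"

lemma linfun_add: "linfun V l \<Longrightarrow> x \<in> vcar V \<Longrightarrow> y \<in> vcar V \<Longrightarrow> l (vadd V x y) = l x + l y"
  and linfun_smul: "linfun V l \<Longrightarrow> x \<in> vcar V \<Longrightarrow> l (vsmul V c x) = c * l x"
  by (auto simp: linfun_def)

lemma linfun_zero: "vs V \<Longrightarrow> linfun V l \<Longrightarrow> l (vzero V) = 0"
  using linfun_smul[of V l "vzero V" 0] vspace.smul_zero_right[of V 0] vspace.zero_closed[of V]
  by (simp add: vspace_def)

lemma linfun_sub: "vs V \<Longrightarrow> linfun V l \<Longrightarrow> x \<in> vcar V \<Longrightarrow> y \<in> vcar V \<Longrightarrow> l (vsub V x y) = l x - l y"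
  by (simp add: vsub_def linfun_add linfun_smul vspace.smul_closed vspace_def)

text \<open>A basis \<open>X'\<close> of the span of the functionals \<open>k p\<close> together
  with a biorthogonal system of vectors. The last clause is the expansion in this basis; it speaks
  of functionals vanishing on the common kernel, so that no span has to be formed.\<close>

definition dual_family ::
  "('a, 'k::real_normed_field, 'z) tvs_scheme \<Rightarrow> 'p set \<Rightarrow> ('p \<Rightarrow> 'a \<Rightarrow> 'k) \<Rightarrow> 'p set \<Rightarrow> ('p \<Rightarrow> 'a) \<Rightarrow> bool" where
  "dual_family V X k X' s \<longleftrightarrow> X' \<subseteq> X \<and> s ` X' \<subseteq> vcar V \<and>
     (\<forall>p\<in>X'. \<forall>p'\<in>X'. k p (s p') = (if p = p' then 1 else 0)) \<and>
     (\<forall>l. linfun V l \<and> (\<forall>x\<in>vcar V. (\<forall>p\<in>X. k p x = 0) \<longrightarrow> l x = 0) \<longrightarrow>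
        (\<forall>x\<in>vcar V. l x = (\<Sum>p\<in>X'. k p x * l (s p))))"

text \<open>Gaussian elimination: a functional not vanishing on the common kernel of the earlier ones
contributes a new dual vector, with which the earlier dual vectors are corrected.\<close>

lemma dual_family_exists:
  assumes "vs V" "finite X" "\<forall>p\<in>X. linfun V (k p)"
  shows "\<exists>X' s. dual_family V X k X' s"
  using assms(2,3)
proof (induction X)
  case empty
  have "dual_family V {} k {} undefined" by (auto simp: dual_family_def)
  then show ?case by blast
next
  case (insert z X)
  interpret vspace V using assms(1) by unfold_locales
  obtain X' s where D: "dual_family V X k X' s" using insert by auto
  have lin: "linfun V (k p)" if "p \<in> insert z X" for p using insert.prems that by blast
  have fin: "finite X'" and zX': "z \<notin> X'" and sV: "\<And>p. p \<in> X' \<Longrightarrow> s p \<in> vcar V"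
    and XX: "X' \<subseteq> X"
    using D insert.hyps by (auto simp: dual_family_def intro: finite_subset)
  have delta: "\<And>p p'. p \<in> X' \<Longrightarrow> p' \<in> X' \<Longrightarrow> k p (s p') = (if p = p' then 1 else 0)"
    using D by (auto simp: dual_family_def)
  show ?case
  proof (cases "\<forall>x\<in>vcar V. (\<forall>p\<in>X. k p x = 0) \<longrightarrow> k z x = 0")
    case True
    then have "(\<forall>p\<in>insert z X. k p x = 0) \<longleftrightarrow> (\<forall>p\<in>X. k p x = 0)" if "x \<in> vcar V" for x
      using that by blast
    then have "dual_family V (insert z X) k X' s"
      using D unfolding dual_family_def by (simp add: subset_insertI2)
    then show ?thesis by blast
  next
    case False
    then obtain w0 where w0: "w0 \<in> vcar V" "\<forall>p\<in>X. k p w0 = 0" "k z w0 \<noteq> 0" by blast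
    define w where "w = vsmul V (1 / k z w0) w0"
    have w: "w \<in> vcar V" "\<And>p. p \<in> X \<Longrightarrow> k p w = 0" "k z w = 1"
      using w0 lin by (auto simp: w_def linfun_smul)
    define s' where "s' = (\<lambda>p. if p = z then w else vadd V (s p) (vsmul V (- k z (s p)) w))"
    have "dual_family V (insert z X) k (insert z X') s'"
      unfolding dual_family_def
    proof (intro conjI allI impI)
      show "insert z X' \<subseteq> insert z X" using XX by blast
      show "s' ` insert z X' \<subseteq> vcar V" using w sV by (auto simp: s'_def)
      show "\<forall>p\<in>insert z X'. \<forall>p'\<in>insert z X'. k p (s' p') = (if p = p' then 1 else 0)"
        using w lin sV delta zX' XX
        by (auto simp: s'_def linfun_add linfun_smul subset_iff)
      fix l assume l: "linfun V l \<and> (\<forall>x\<in>vcar V. (\<forall>p\<in>insert z X. k p x = 0) \<longrightarrow> l x = 0)"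
      \<comment> \<open>Subtracting the \<open>k z\<close> part yields a functional that vanishes on
        the common kernel of \<open>X\<close> alone: for \<open>x\<close> in that kernel,
        \<open>x\<close> minus \<open>k z x\<close> times \<open>w\<close> is also killed by
        \<open>k z\<close>.\<close>
      define l' where "l' = (\<lambda>x. l x - l w * k z x)"
      have "linfun V l'"
        using l lin[of z] by (auto simp: linfun_def l'_def algebra_simps)
      moreover have "l' x = 0" if x: "x \<in> vcar V" "\<forall>p\<in>X. k p x = 0" for x
      proof -
        let ?y = "vadd V x (vsmul V (- k z x) w)"
        have "?y \<in> vcar V" using x w by simp
        moreover have "k p ?y = 0" if "p \<in> insert z X" for p
          using x w lin[OF that] that by (auto simp: linfun_add linfun_smul)
        ultimately have "l ?y = 0" using l by blast
        then show ?thesis using l x w by (auto simp: l'_def linfun_add linfun_smul algebra_simps)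
      qed
      ultimately have E: "\<forall>x\<in>vcar V. l' x = (\<Sum>p\<in>X'. k p x * l' (s p))"
        using D unfolding dual_family_def by blast
      show "\<forall>x\<in>vcar V. l x = (\<Sum>p\<in>insert z X'. k p x * l (s' p))"
      proof
        fix x assume x: "x \<in> vcar V"
        have "(\<Sum>p\<in>X'. k p x * l (s' p)) = (\<Sum>p\<in>X'. k p x * l' (s p))"
        proof (rule sum.cong[OF refl])
          fix p assume p: "p \<in> X'"
          then have "p \<noteq> z" using zX' by blast
          then show "k p x * l (s' p) = k p x * l' (s p)"
            using p l w sV by (simp add: s'_def l'_def linfun_add linfun_smul)
        qed
        moreover have "l' x = (\<Sum>p\<in>X'. k p x * l' (s p))" using E x by blast
        moreover have "(\<Sum>p\<in>insert z X'. k p x * l (s' p))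
            = k z x * l (s' z) + (\<Sum>p\<in>X'. k p x * l (s' p))"
          using fin zX' by simp
        moreover have "l (s' z) = l w" "l' x = l x - l w * k z x" by (simp_all add: s'_def l'_def)
        ultimately show "l x = (\<Sum>p\<in>insert z X'. k p x * l (s' p))" by (simp add: algebra_simps)
      qed
    qed
    then show ?thesis by blast
  qed
qed

text \<open>By biorthogonality the sum of the vectors \<open>d p\<close> times \<open>s p\<close> is
  a solution; the induction on \<open>G\<close> builds this sum term by term.\<close>

lemma dual_family_surj:
  assumes "vs V" "finite X'" "\<forall>p\<in>X'. linfun V (k p)" "dual_family V X k X' s"
  shows "\<exists>x\<in>vcar V. \<forall>p\<in>X'. k p x = d p"
proof -
  interpret vspace V using assms(1) by unfold_locales
  have "\<exists>x\<in>vcar V. \<forall>p\<in>X'. k p x = (if p \<in> G then d p else 0)" if "finite G" "G \<subseteq> X'" for G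
    using that
  proof (induction G)
    case empty
    then show ?case using assms linfun_zero by (intro bexI[of _ "vzero V"]) auto
  next
    case (insert q G)
    then obtain x where x: "x \<in> vcar V" "\<forall>p\<in>X'. k p x = (if p \<in> G then d p else 0)" by auto
    have s: "s q \<in> vcar V" "\<And>p. p \<in> X' \<Longrightarrow> k p (s q) = (if p = q then 1 else 0)"
      using assms(4) insert.prems by (auto simp: dual_family_def)
    show ?case
      using x s insert assms(3)
      by (intro bexI[of _ "vadd V x (vsmul V (d q) (s q))"]) (auto simp: linfun_add linfun_smul)
  qed
  from this[of X'] show ?thesis using assms(2) by auto
qed

section \<open>Ideals of finite codimension\<close>

definition subspc :: "('a, 'k::real_normed_field, 'z) tvs_scheme \<Rightarrow> 'a set \<Rightarrow> bool" where
  "subspc V M \<longleftrightarrow> M \<subseteq> vcar V \<and> vzero V \<in> M \<and> (\<forall>x\<in>M. \<forall>y\<in>M. vadd V x y \<in> M) \<and> (\<forall>c. \<forall>x\<in>M. vsmul V c x \<in> M)"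

text \<open>This is M + span(ws), adjoining one generator at a time. The recursion permits induction
  on the generators, which the coefficient lists of \<open>fin_codim\<close> make awkward.\<close>

fun span_over :: "('a, 'k::real_normed_field, 'z) tvs_scheme \<Rightarrow> 'a set \<Rightarrow> 'a list \<Rightarrow> 'a set" where
  "span_over V M [] = M"
| "span_over V M (w # ws) = {x \<in> vcar V. \<exists>c. vsub V x (vsmul V c w) \<in> span_over V M ws}"

context vspace
begin

lemma subspc_span_over:
  assumes "subspc V M" "set ws \<subseteq> vcar V"
  shows "subspc V (span_over V M ws)"
  using assms(2)
proof (induction ws)
  case (Cons w ws)
  then have S: "subspc V (span_over V M ws)" and w: "w \<in> vcar V" by auto
  show ?case unfolding subspc_def
  proof (intro conjI ballI allI)
    show "vzero V \<in> span_over V M (w # ws)"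
      using S w by (auto simp: subspc_def intro: exI[of _ 0])
  next
    fix x y assume "x \<in> span_over V M (w # ws)" "y \<in> span_over V M (w # ws)"
    then obtain c d where x: "x \<in> vcar V" "vsub V x (vsmul V c w) \<in> span_over V M ws"
      and y: "y \<in> vcar V" "vsub V y (vsmul V d w) \<in> span_over V M ws" by auto
    have "vsub V (vadd V x y) (vsmul V (c + d) w) \<in> span_over V M ws"
      using x y w S by (simp add: add_smul sub_add_distrib subspc_def)
    then show "vadd V x y \<in> span_over V M (w # ws)" using x y by auto
  next
    fix a x assume "x \<in> span_over V M (w # ws)"
    then obtain c where x: "x \<in> vcar V" "vsub V x (vsmul V c w) \<in> span_over V M ws" by auto
    have "vsmul V a (vsub V x (vsmul V c w)) \<in> span_over V M ws" using x S by (simp add: subspc_def)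
    then have "vsub V (vsmul V a x) (vsmul V (a * c) w) \<in> span_over V M ws"
      using x w by (simp add: smul_sub_distrib smul_smul)
    then show "vsmul V a x \<in> span_over V M (w # ws)" using x by auto
  qed auto
qed (use assms in auto)

lemma span_over_mono: "M \<subseteq> N \<Longrightarrow> span_over V M ws \<subseteq> span_over V N ws"
  by (induction ws) auto

lemma span_over_append: "span_over V M (ws @ us) = span_over V (span_over V M us) ws"
  by (induction ws) auto

lemma span_over_iff:
  assumes "M \<subseteq> vcar V" "set ws \<subseteq> vcar V" "x \<in> vcar V"
  shows "x \<in> span_over V M ws \<longleftrightarrow>
    (\<exists>cs. length cs = length ws \<and> vsub V x (lincomb V (zip cs ws)) \<in> M)"
  using assms(2,3)
proof (induction ws arbitrary: x)
  case (Cons w ws)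
  have *: "vsub V x (lincomb V (zip (c # cs) (w # ws)))
      = vsub V (vsub V x (vsmul V c w)) (lincomb V (zip cs ws))" for c cs
  proof -
    have "snd ` set (zip cs ws) \<subseteq> vcar V" using Cons.prems by (auto dest: set_zip_rightD)
    then show ?thesis using Cons.prems lincomb_closed by (simp add: sub_sub)
  qed
  have "x \<in> span_over V M (w # ws) \<longleftrightarrow>
      (\<exists>c cs. length cs = length ws \<and> vsub V (vsub V x (vsmul V c w)) (lincomb V (zip cs ws)) \<in> M)"
    using Cons by auto
  also have "\<dots> \<longleftrightarrow> (\<exists>cs. length cs = length (w # ws) \<and> vsub V x (lincomb V (zip cs (w # ws))) \<in> M)"
    unfolding * [symmetric] by (metis length_Suc_conv length_Cons)
  finally show ?case .
qed simp

text \<open>Each generator \<open>w\<close> enlarges the intersection with \<open>M\<close> by at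
  most one dimension. If some \<open>m\<close> in \<open>M\<close> has a nonzero
  \<open>w\<close>-component, \<open>m\<close> replaces \<open>w\<close> as a generator; otherwise
  \<open>w\<close> contributes nothing to the intersection.\<close>

lemma span_over_Int:
  assumes I: "subspc V I" and M: "subspc V M" and ws: "set ws \<subseteq> vcar V"
  shows "\<exists>us. set us \<subseteq> vcar V \<and> span_over V I ws \<inter> M \<subseteq> span_over V (I \<inter> M) us"
  using ws
proof (induction ws)
  case Nil
  show ?case by (intro exI[of _ "[]"]) auto
next
  case (Cons w ws)
  then obtain us where us: "set us \<subseteq> vcar V" "span_over V I ws \<inter> M \<subseteq> span_over V (I \<inter> M) us" by auto
  have w: "w \<in> vcar V" and S: "subspc V (span_over V I ws)"
    using Cons.prems subspc_span_over[OF I] by auto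
  show ?case
  proof (cases "\<exists>m\<in>M. \<exists>c. c \<noteq> 0 \<and> vsub V m (vsmul V c w) \<in> span_over V I ws")
    case True
    then obtain m c where m: "m \<in> M" "c \<noteq> 0" "vsub V m (vsmul V c w) \<in> span_over V I ws" by auto
    have mV: "m \<in> vcar V" using m M by (auto simp: subspc_def)
    have "x \<in> span_over V (I \<inter> M) (m # us)" if x: "x \<in> span_over V I (w # ws)" "x \<in> M" for x
    proof -
      obtain d where xV: "x \<in> vcar V" and d: "vsub V x (vsmul V d w) \<in> span_over V I ws" using x by auto
      \<comment> \<open>The factor \<open>t\<close> matches the \<open>w\<close>-components of
        \<open>x\<close> and \<open>m\<close>, so \<open>w\<close> cancels in the difference of
        \<open>x\<close> and \<open>t\<close> times \<open>m\<close>, which still lies in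
        \<open>M\<close>.\<close>
      define t where "t = d / c"
      have tc: "t * c = d" using m by (simp add: t_def)
      have "vadd V (vsub V x (vsmul V d w)) (vsmul V (- t) (vsub V m (vsmul V c w)))
          = vadd V (vadd V x (vsmul V (- t) m)) (vadd V (vsmul V (- d) w) (vsmul V d w))"
        using xV mV w by (simp add: vsub_def smul_add smul_smul add_ac tc)
      also have "\<dots> = vsub V x (vsmul V t m)"
        using xV mV w by (simp add: add_smul_cancel vsub_def smul_smul)
      finally have "vsub V x (vsmul V t m) \<in> span_over V I ws"
        using S d m(3) by (metis subspc_def)
      moreover have "vsub V x (vsmul V t m) \<in> M" using M x m by (simp add: vsub_def subspc_def)
      ultimately show ?thesis using us xV by auto
    qed
    then show ?thesis using us mV by (intro exI[of _ "m # us"]) auto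
  next
    case False
    have "x \<in> span_over V I ws" if x: "x \<in> span_over V I (w # ws)" "x \<in> M" for x
    proof -
      obtain d where "x \<in> vcar V" "vsub V x (vsmul V d w) \<in> span_over V I ws" using x by auto
      moreover from this have "d = 0" using False x by blast
      ultimately show ?thesis using w by simp
    qed
    then show ?thesis using us by blast
  qed
qed

end

section \<open>Finite codimension of intersections and kernels\<close>

lemma fin_codim_iff_span_over:
  assumes "vs L" "I \<subseteq> vcar L"
  shows "fin_codim L I \<longleftrightarrow> (\<exists>ws. set ws \<subseteq> vcar L \<and> vcar L \<subseteq> span_over L I ws)"
proof -
  interpret vspace L using assms(1) by unfold_locales
  have "vcar L \<subseteq> span_over L I ws \<longleftrightarrow> (\<forall>x\<in>vcar L. \<exists>cs. length cs = length ws \<and>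
      vsub L x (lincomb L (zip cs ws)) \<in> I)" if "set ws \<subseteq> vcar L" for ws
    using span_over_iff[OF assms(2) that] by blast
  then show ?thesis unfolding fin_codim_def by auto
qed

text \<open>Codimensions add along the chain from \<open>L\<close> to \<open>J\<close> to the
  intersection: \<open>vs\<close> generates \<open>L\<close> over \<open>J\<close>, and
  \<open>us\<close> generates \<open>J\<close> over the intersection.\<close>

lemma fin_codim_Int:
  assumes "vs L" "subspc L I" "subspc L J" "fin_codim L I" "fin_codim L J"
  shows "fin_codim L (I \<inter> J)"
proof -
  interpret vspace L using assms(1) by unfold_locales
  have IJ: "I \<subseteq> vcar L" "J \<subseteq> vcar L" using assms by (auto simp: subspc_def)
  obtain ws vs where ws: "set ws \<subseteq> vcar L" "vcar L \<subseteq> span_over L I ws"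
    and vs: "set vs \<subseteq> vcar L" "vcar L \<subseteq> span_over L J vs"
    using assms(4,5) unfolding fin_codim_iff_span_over[OF assms(1) IJ(1)]
      fin_codim_iff_span_over[OF assms(1) IJ(2)] by blast
  obtain us where us: "set us \<subseteq> vcar L" "span_over L I ws \<inter> J \<subseteq> span_over L (I \<inter> J) us"
    using span_over_Int[OF assms(2,3) ws(1)] by blast
  have "J \<subseteq> span_over L (I \<inter> J) us" using us ws IJ by blast
  then have "vcar L \<subseteq> span_over L (I \<inter> J) (vs @ us)"
    using vs span_over_mono unfolding span_over_append by blast
  then show ?thesis using assms(1) IJ vs us
    by (subst fin_codim_iff_span_over) (auto intro!: exI[of _ "vs @ us"])
qed

lemma fin_codim_carrier: "vs L \<Longrightarrow> fin_codim L (vcar L)"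
  by (subst fin_codim_iff_span_over) (auto intro!: exI[of _ "[]"])

lemma subspc_ker: "vs L \<Longrightarrow> linfun L l \<Longrightarrow> subspc L {x \<in> vcar L. l x = 0}"
  by (auto simp: subspc_def linfun_zero linfun_add linfun_smul vspace_def
      intro: vspace.zero_closed vspace.add_closed vspace.smul_closed)

lemma fin_codim_ker:
  assumes "vs L" "linfun L l"
  shows "fin_codim L {x \<in> vcar L. l x = 0}"
proof (cases "\<forall>x\<in>vcar L. l x = 0")
  case True
  then have "{x \<in> vcar L. l x = 0} = vcar L" by auto
  then show ?thesis using fin_codim_carrier[OF assms(1)] by simp
next
  case False
  interpret vspace L using assms(1) by unfold_locales
  obtain w where w: "w \<in> vcar L" "l w \<noteq> 0" using False by blast
  have "vcar L \<subseteq> span_over L {x \<in> vcar L. l x = 0} [w]"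
  proof
    fix x assume "x \<in> vcar L"
    then show "x \<in> span_over L {x \<in> vcar L. l x = 0} [w]"
      using w assms by (auto simp: linfun_sub linfun_smul intro!: exI[of _ "l x / l w"])
  qed
  then show ?thesis using w assms
    by (subst fin_codim_iff_span_over) (auto simp del: span_over.simps intro!: exI[of _ "[w]"])
qed

lemma fin_codim_common_ker:
  assumes "vs L" "finite X" "\<forall>p\<in>X. linfun L (l p)"
  shows "fin_codim L {x \<in> vcar L. \<forall>p\<in>X. l p x = 0} \<and> subspc L {x \<in> vcar L. \<forall>p\<in>X. l p x = 0}"
  using assms(2,3)
proof (induction X)
  case empty
  then show ?case using fin_codim_carrier[OF assms(1)] assms(1)
    by (auto simp: subspc_def vs_def)
next
  case (insert q X)
  have eq: "{x \<in> vcar L. \<forall>p\<in>insert q X. l p x = 0}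
      = {x \<in> vcar L. l q x = 0} \<inter> {x \<in> vcar L. \<forall>p\<in>X. l p x = 0}" by auto
  have "subspc L {x \<in> vcar L. l q x = 0}" "fin_codim L {x \<in> vcar L. l q x = 0}"
    using insert.prems subspc_ker fin_codim_ker assms(1) by blast+
  then show ?case unfolding eq using insert fin_codim_Int[OF assms(1)] by (auto simp: subspc_def)
qed

section \<open>Coordinates on weakly complete spaces\<close>

lemma continuous_map_mult_field [continuous_intros]:
  fixes f g :: "'a \<Rightarrow> 'k::real_normed_field"
  assumes "continuous_map X euclidean f" "continuous_map X euclidean g"
  shows "continuous_map X euclidean (\<lambda>x. f x * g x)"
  using assms by (simp add: continuous_map_atin tendsto_mult)

lemma continuous_map_power_coordinate [continuous_intros]:
  "i \<in> I \<Longrightarrow> continuous_map (product_topology (\<lambda>_. T) I) T (\<lambda>x. x i)"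
  by (rule continuous_map_product_coordinates)

text \<open>The chart condition of \<open>wcs\<close>, but with an index set of any type: charts of
  the finite-dimensional quotients are indexed by triples of coordinates.\<close>

definition coords :: "('a, 'k::real_normed_field, 'z) tvs_scheme \<Rightarrow> 'i set \<Rightarrow> ('a \<Rightarrow> 'i \<Rightarrow> 'k) \<Rightarrow> bool" where
  "coords V J f \<longleftrightarrow>
     homeomorphic_map (vtop V) (product_topology (\<lambda>_. euclidean) J) f \<and>
     (\<forall>x\<in>vcar V. \<forall>y\<in>vcar V. f (vadd V x y) = (\<lambda>j\<in>J. f x j + f y j)) \<and>
     (\<forall>c. \<forall>x\<in>vcar V. f (vsmul V c x) = (\<lambda>j\<in>J. c * f x j))"

lemma coords_linfun: "coords V J f \<Longrightarrow> j \<in> J \<Longrightarrow> linfun V (\<lambda>x. f x j)"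
  by (auto simp: coords_def linfun_def)

lemma coords_continuous:
  assumes "coords V J f" "j \<in> J"
  shows "continuous_map (vtop V) euclidean (\<lambda>x. f x j)"
proof -
  have "continuous_map (vtop V) (product_topology (\<lambda>_. euclidean) J) f"
    using assms(1) by (simp add: coords_def homeomorphic_imp_continuous_map)
  from continuous_map_compose[OF this continuous_map_product_coordinates[OF assms(2)]]
  show ?thesis by (simp add: o_def)
qed

lemma coords_inverse:
  fixes V :: "('a, 'k::real_normed_field, 'z) tvs_scheme" and J :: "'i set"
  assumes "coords V J f"
  obtains h where "continuous_map (product_topology (\<lambda>_. euclidean) J) (vtop V) h"
    "\<And>x. x \<in> topspace (vtop V) \<Longrightarrow> h (f x) = x" "\<And>x. x \<in> topspace (vtop V) \<Longrightarrow> f x \<in> extensional J"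
    "\<And>d. d \<in> extensional J \<Longrightarrow> h d \<in> topspace (vtop V) \<and> f (h d) = d"
proof -
  obtain h where h: "homeomorphic_maps (vtop V) (product_topology (\<lambda>_. euclidean) J) f h"
    using assms by (auto simp: coords_def homeomorphic_map_maps)
  have ext: "d \<in> topspace (product_topology (\<lambda>_. euclidean) J) \<longleftrightarrow> d \<in> extensional J" for d :: "'i \<Rightarrow> 'k"
    by (simp add: PiE_def)
  have c: "continuous_map (vtop V) (product_topology (\<lambda>_. euclidean) J) f"
    "continuous_map (product_topology (\<lambda>_. euclidean) J) (vtop V) h"
    and inv: "\<And>x. x \<in> topspace (vtop V) \<Longrightarrow> h (f x) = x" 
    "\<And>d. d \<in> topspace (product_topology (\<lambda>_. euclidean) J) \<Longrightarrow> f (h d) = d"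
    using h unfolding homeomorphic_maps_def by blast+
  show thesis
    using c(2) inv(1)
  proof (rule that)
    show "f x \<in> extensional J" if "x \<in> topspace (vtop V)" for x
      using continuous_map_funspace[OF c(1)] that unfolding ext[symmetric] by blast
    show "h d \<in> topspace (vtop V) \<and> f (h d) = d" if "d \<in> extensional J" for d
      using continuous_map_funspace[OF c(2)] inv(2) that unfolding ext[symmetric] by blast
  qed
qed

lemma coords_eqI:
  assumes "coords V J f" "topspace (vtop V) = vcar V" "x \<in> vcar V" "y \<in> vcar V"
    and "\<And>j. j \<in> J \<Longrightarrow> f x j = f y j"
  shows "x = y"
proof -
  obtain h where h: "\<And>x. x \<in> vcar V \<Longrightarrow> h (f x) = x" "\<And>x. x \<in> vcar V \<Longrightarrow> f x \<in> extensional J"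
    using coords_inverse[OF assms(1)] assms(2) by metis
  have "f x = f y" using h(2) assms by (intro extensionalityI[of _ J]) auto
  then show ?thesis using h(1) assms(3,4) by metis
qed

text \<open>A chart gives the space the initial topology of its coordinates, so continuity into it
  is tested coordinatewise.\<close>

lemma coords_continuous_into:
  assumes "coords V J f" "topspace (vtop V) = vcar V" "\<And>t. t \<in> topspace T \<Longrightarrow> u t \<in> vcar V"
    and "\<And>j. j \<in> J \<Longrightarrow> continuous_map T euclidean (\<lambda>t. f (u t) j)"
  shows "continuous_map T (vtop V) u"
proof -
  obtain h where h: "continuous_map (product_topology (\<lambda>_. euclidean) J) (vtop V) h"
    "\<And>x. x \<in> vcar V \<Longrightarrow> h (f x) = x" "\<And>x. x \<in> vcar V \<Longrightarrow> f x \<in> extensional J"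
    using coords_inverse[OF assms(1)] assms(2) by metis
  have "continuous_map T (product_topology (\<lambda>_. euclidean) J) (\<lambda>t. f (u t))"
    using assms(3,4) h(3) by (auto simp: continuous_map_componentwise)
  from continuous_map_compose[OF this h(1)] show ?thesis
    by (rule continuous_map_eq) (use assms(3) h(2) in auto)
qed

text \<open>A basic open box around \<open>f x\<close> restricts only finitely many coordinates, and
  a point that agrees with \<open>x\<close> in these lies in the box. At \<open>x = 0\<close> this
  places a whole subspace inside the neighbourhood.\<close>

lemma coords_nbhd:
  fixes V :: "('a, 'k::real_normed_field, 'z) tvs_scheme" and J :: "'i set"
  assumes "coords V J f" "topspace (vtop V) = vcar V" "openin (vtop V) T" "x \<in> T"
  shows "\<exists>F\<subseteq>J. finite F \<and> (\<forall>y\<in>vcar V. (\<forall>j\<in>F. f y j = f x j) \<longrightarrow> y \<in> T)"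
proof -
  let ?P = "product_topology (\<lambda>_. euclidean) J :: ('i \<Rightarrow> 'k) topology"
  obtain h where h: "continuous_map ?P (vtop V) h"
    "\<And>x. x \<in> vcar V \<Longrightarrow> h (f x) = x" "\<And>x. x \<in> vcar V \<Longrightarrow> f x \<in> extensional J"
    using coords_inverse[OF assms(1)] assms(2) by metis
  have x: "x \<in> vcar V" using assms(2-4) openin_subset by blast
  let ?W = "{d \<in> topspace ?P. h d \<in> T}"
  have "openin ?P ?W" using h(1) assms(3) by (rule openin_continuous_map_preimage)
  moreover have "f x \<in> ?W" using h x assms(4) by (simp add: PiE_def)
  ultimately obtain U where U: "finite {i \<in> J. U i \<noteq> UNIV}" "f x \<in> Pi\<^sub>E J U" "Pi\<^sub>E J U \<subseteq> ?W"
    unfolding openin_product_topology_alt topspace_euclidean by blast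
  show ?thesis
  proof (intro exI[of _ "{i \<in> J. U i \<noteq> UNIV}"] conjI ballI impI)
    fix y assume y: "y \<in> vcar V" "\<forall>j\<in>{i \<in> J. U i \<noteq> UNIV}. f y j = f x j"
    have "f y \<in> Pi\<^sub>E J U"
    proof (rule PiE_I)
      fix j assume "j \<in> J"
      then show "f y j \<in> U j" using y U(2) by (cases "U j = UNIV") (auto dest: PiE_mem)
    next
      fix j assume "j \<notin> J"
      then show "f y j = undefined" using h(3) y by (auto simp: extensional_def)
    qed
    then have "h (f y) \<in> T" using U(3) by blast
    then show "y \<in> T" using h(2) y by simp
  qed (use U in auto)
qed

lemma coords_Hausdorff:
  fixes V :: "('a, 'k::real_normed_field, 'z) tvs_scheme" and J :: "'i set"
  assumes "coords V J f"
  shows "Hausdorff_space (vtop V)"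
proof -
  have "vtop V homeomorphic_space (product_topology (\<lambda>_. euclidean :: 'k topology) J)"
    using assms unfolding coords_def homeomorphic_space_def homeomorphic_map_maps by blast
  then show ?thesis
    by (simp add: homeomorphic_Hausdorff_space Hausdorff_space_product_topology)
qed

lemma coordsI:
  fixes V :: "('a, 'k::real_normed_field, 'z) tvs_scheme" and J :: "'i set"
  assumes top: "topspace (vtop V) = vcar V"
    and cont: "\<And>j. j \<in> J \<Longrightarrow> continuous_map (vtop V) euclidean (\<lambda>x. k j x)"
    and lin: "\<And>j. j \<in> J \<Longrightarrow> linfun V (k j)"
    and h: "continuous_map (product_topology (\<lambda>_. euclidean) J) (vtop V) h"
    and hk: "\<And>x. x \<in> vcar V \<Longrightarrow> h (\<lambda>j\<in>J. k j x) = x"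
    and kh: "\<And>d j. d \<in> extensional J \<Longrightarrow> j \<in> J \<Longrightarrow> k j (h d) = d j"
  shows "coords V J (\<lambda>x. \<lambda>j\<in>J. k j x)"
  unfolding coords_def
proof (intro conjI)
  have "homeomorphic_maps (vtop V) (product_topology (\<lambda>_. euclidean) J) (\<lambda>x. \<lambda>j\<in>J. k j x) h"
    unfolding homeomorphic_maps_def
  proof (intro conjI ballI)
    show "continuous_map (vtop V) (product_topology (\<lambda>_. euclidean) J) (\<lambda>x. \<lambda>j\<in>J. k j x)"
      using cont by (auto simp: continuous_map_componentwise)
    fix d :: "'i \<Rightarrow> 'k" assume "d \<in> topspace (product_topology (\<lambda>_. euclidean) J)"
    then have "d \<in> extensional J" by (simp add: PiE_def)
    then show "(\<lambda>j\<in>J. k j (h d)) = d"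
      using kh by (intro extensionalityI[of _ J]) auto
  qed (use h hk top in auto)
  then show "homeomorphic_map (vtop V) (product_topology (\<lambda>_. euclidean) J) (\<lambda>x. \<lambda>j\<in>J. k j x)"
    unfolding homeomorphic_map_maps by blast
qed (use lin in \<open>auto simp: linfun_def fun_eq_iff restrict_def\<close>)

text \<open>Continuity of addition and scalar multiplication is inherited from the field through the
  coordinates. The injection \<iota> moves the index set into the carrier type, where
  \<open>wcs\<close> requires it.\<close>

lemma wcsI:
  fixes V :: "('a, 'k::real_normed_field, 'z) tvs_scheme" and J :: "'i set" and \<iota> :: "'i \<Rightarrow> 'a"
  assumes vs: "vs V" and top: "topspace (vtop V) = vcar V" and co: "coords V J f" and inj: "inj_on \<iota> J"
  shows "wcs V"
proof -
  interpret vspace V using vs by unfold_locales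
  have 1: "continuous_map (prod_topology (vtop V) (vtop V)) (vtop V) (\<lambda>(x, y). vadd V x y)"
  proof (rule coords_continuous_into[OF co top])
    fix j assume j: "j \<in> J"
    have "continuous_map (prod_topology (vtop V) (vtop V)) euclidean (\<lambda>t. f (fst t) j + f (snd t) j)"
      using continuous_map_compose[OF continuous_map_fst coords_continuous[OF co j]]
        continuous_map_compose[OF continuous_map_snd coords_continuous[OF co j]]
      by (intro continuous_map_add) (auto simp: o_def)
    then show "continuous_map (prod_topology (vtop V) (vtop V)) euclidean
        (\<lambda>t. f (case t of (x, y) \<Rightarrow> vadd V x y) j)"
      by (rule continuous_map_eq) (use linfun_add[OF coords_linfun[OF co j]] top in auto)
  next
    fix t assume "t \<in> topspace (prod_topology (vtop V) (vtop V))"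
    then show "(case t of (x, y) \<Rightarrow> vadd V x y) \<in> vcar V" by (cases t) (simp add: top)
  qed
  have 2: "continuous_map (prod_topology euclidean (vtop V)) (vtop V) (\<lambda>(c, x). vsmul V c x)"
  proof (rule coords_continuous_into[OF co top])
    fix j assume j: "j \<in> J"
    have "continuous_map (prod_topology euclidean (vtop V)) euclidean (\<lambda>t. fst t * f (snd t) j)"
      using continuous_map_compose[OF continuous_map_snd coords_continuous[OF co j]] continuous_map_fst
      by (intro continuous_map_mult_field) (auto simp: o_def)
    then show "continuous_map (prod_topology euclidean (vtop V)) euclidean
        (\<lambda>t. f (case t of (c, x) \<Rightarrow> vsmul V c x) j)"
      by (rule continuous_map_eq) (use linfun_smul[OF coords_linfun[OF co j]] top in auto)
  next
    fix t assume "t \<in> topspace (prod_topology (euclidean :: 'k topology) (vtop V))"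
    then show "(case t of (c, x) \<Rightarrow> vsmul V c x) \<in> vcar V" by (cases t) (simp add: top)
  qed
  obtain h where h: "continuous_map (product_topology (\<lambda>_. euclidean) J) (vtop V) h"
    "\<And>x. x \<in> vcar V \<Longrightarrow> h (f x) = x" "\<And>x. x \<in> vcar V \<Longrightarrow> f x \<in> extensional J"
    "\<And>d. d \<in> extensional J \<Longrightarrow> h d \<in> vcar V \<and> f (h d) = d"
    using coords_inverse[OF co] top by metis
  have inv: "inv_into J \<iota> (\<iota> j) = j" if "j \<in> J" for j using inj that by simp
  have "coords V (\<iota> ` J) (\<lambda>x. \<lambda>i\<in>\<iota> ` J. f x (inv_into J \<iota> i))"
  proof (rule coordsI[OF top])
    let ?h = "\<lambda>d. h (\<lambda>j\<in>J. d (\<iota> j))"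
    have "continuous_map (product_topology (\<lambda>_. euclidean) (\<iota> ` J)) (product_topology (\<lambda>_. euclidean) J)
       (\<lambda>d. \<lambda>j\<in>J. d (\<iota> j) :: 'k)"
      by (auto simp: continuous_map_componentwise continuous_map_power_coordinate)
    from continuous_map_compose[OF this h(1)]
    show "continuous_map (product_topology (\<lambda>_. euclidean) (\<iota> ` J)) (vtop V) ?h" by (simp add: o_def)
    show "?h (\<lambda>i\<in>\<iota> ` J. f x (inv_into J \<iota> i)) = x" if x: "x \<in> vcar V" for x
    proof -
      have "(\<lambda>j\<in>J. (\<lambda>i\<in>\<iota> ` J. f x (inv_into J \<iota> i)) (\<iota> j)) = f x"
        using h(3)[OF x] inv by (intro extensionalityI[of _ J]) auto
      then show ?thesis using h(2)[OF x] by simp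
    qed
    show "f (?h d) (inv_into J \<iota> i) = d i" if "d \<in> extensional (\<iota> ` J)" "i \<in> \<iota> ` J" for d i
      using h(4)[of "\<lambda>j\<in>J. d (\<iota> j)"] that inv by auto
  qed (use coords_continuous[OF co] coords_linfun[OF co] inv in auto)
  then show ?thesis unfolding wcs_def tvs_def coords_def using vs top 1 2 by blast
qed

section \<open>Finite-dimensional quotients of weakly complete algebras\<close>

text \<open>The topology-free part of \<open>wc_alg\<close>. It passes to images by pure algebra,
  before the image has been shown to be weakly complete.\<close>

definition alg_ax :: "('a, 'k::real_normed_field) alg \<Rightarrow> bool" where
  "alg_ax A \<longleftrightarrow> vs A \<and> aone A \<in> vcar A \<and>
     (\<forall>x\<in>vcar A. \<forall>y\<in>vcar A. amul A x y \<in> vcar A) \<and>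
     (\<forall>x\<in>vcar A. \<forall>y\<in>vcar A. \<forall>z\<in>vcar A. amul A (amul A x y) z = amul A x (amul A y z)) \<and>
     (\<forall>x\<in>vcar A. amul A (aone A) x = x \<and> amul A x (aone A) = x) \<and>
     (\<forall>x\<in>vcar A. \<forall>y\<in>vcar A. \<forall>z\<in>vcar A.
        amul A (vadd A x y) z = vadd A (amul A x z) (amul A y z) \<and>
        amul A z (vadd A x y) = vadd A (amul A z x) (amul A z y)) \<and>
     (\<forall>c. \<forall>x\<in>vcar A. \<forall>y\<in>vcar A.
        amul A (vsmul A c x) y = vsmul A c (amul A x y) \<and>
        amul A x (vsmul A c y) = vsmul A c (amul A x y))"

lemma wc_alg_alg_ax: "wc_alg A \<Longrightarrow> alg_ax A"
  by (simp add: wc_alg_def alg_ax_def wcs_def tvs_def)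

lemma wc_alg_topspace: "wc_alg A \<Longrightarrow> topspace (vtop A) = vcar A"
  by (simp add: wc_alg_def wcs_def tvs_def)

lemma wc_algI:
  fixes A :: "('a, 'k::real_normed_field) alg"
  assumes "alg_ax A" "topspace (vtop A) = vcar A" "coords A J f" "inj_on (\<iota> :: 'i \<Rightarrow> 'a) J"
    and "continuous_map (prod_topology (vtop A) (vtop A)) (vtop A) (\<lambda>(x, y). amul A x y)"
  shows "wc_alg A"
proof -
  have "vs A" using assms(1) by (simp add: alg_ax_def)
  from wcsI[OF this assms(2,3,4)] show ?thesis
    using assms(1,5) by (simp add: alg_ax_def wc_alg_def)
qed

definition subalg :: "('a, 'k::real_normed_field) alg \<Rightarrow> 'a set \<Rightarrow> bool" where
  "subalg A S \<longleftrightarrow> subspc A S \<and> aone A \<in> S \<and> (\<forall>x\<in>S. \<forall>y\<in>S. amul A x y \<in> S)"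

text \<open>Equational laws survive homomorphic images. Compatibility is demanded on
  \<open>S\<close> only, so that images of subalgebras are covered as well as quotients of the whole
  algebra.\<close>

lemma alg_ax_image:
  assumes A: "alg_ax A" and S: "subalg A S" and car: "vcar Q = q ` S"
    and zero: "vzero Q = q (vzero A)" and one: "aone Q = q (aone A)"
    and add: "\<And>x y. x \<in> S \<Longrightarrow> y \<in> S \<Longrightarrow> vadd Q (q x) (q y) = q (vadd A x y)"
    and smul: "\<And>c x. x \<in> S \<Longrightarrow> vsmul Q c (q x) = q (vsmul A c x)"
    and mul: "\<And>x y. x \<in> S \<Longrightarrow> y \<in> S \<Longrightarrow> amul Q (q x) (q y) = q (amul A x y)"
  shows "alg_ax Q"
proof -
  interpret vspace A using A by unfold_locales (simp add: alg_ax_def)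
  have cl: "vzero A \<in> S" "aone A \<in> S" "\<And>x y. x \<in> S \<Longrightarrow> y \<in> S \<Longrightarrow> vadd A x y \<in> S"
    "\<And>x y. x \<in> S \<Longrightarrow> y \<in> S \<Longrightarrow> amul A x y \<in> S" "\<And>c x. x \<in> S \<Longrightarrow> vsmul A c x \<in> S"
    and sub: "\<And>x. x \<in> S \<Longrightarrow> x \<in> vcar A"
    using S by (auto simp: subalg_def subspc_def)
  note hom = zero one add smul mul cl
  have "vs Q"
    unfolding vs_def car ball_simps(9)
  proof (intro conjI ballI allI)
    fix x assume x: "x \<in> S"
    have "vadd A x (vsmul A (-1) x) = vzero A" using sub_self[OF sub[OF x]] by (simp add: vsub_def)
    then show "\<exists>y\<in>q ` S. vadd Q (q x) y = vzero Q"
      using x hom by (intro bexI[of _ "q (vsmul A (-1) x)"]) auto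
  next
    fix x y z assume "x \<in> S" "y \<in> S" "z \<in> S"
    then show "vadd Q (vadd Q (q x) (q y)) (q z) = vadd Q (q x) (vadd Q (q y) (q z))"
      using hom sub by (simp add: add_assoc)
  next
    fix x y assume "x \<in> S" "y \<in> S"
    then show "vadd Q (q x) (q y) = vadd Q (q y) (q x)"
      using hom sub add_commute[of x y] by simp
  qed (use hom sub in \<open>auto simp: smul_add add_smul smul_smul\<close>)
  then show ?thesis
    unfolding alg_ax_def car ball_simps(9)
    using A hom sub unfolding alg_ax_def by (auto simp: subset_iff)
qed

section \<open>Finite-dimensional algebras topologised by separating functionals\<close>

lemma continuous_map_into_pullback:
  assumes "\<And>t. t \<in> topspace T \<Longrightarrow> u t \<in> D"
    and "\<And>p. p \<in> X \<Longrightarrow> continuous_map T euclidean (\<lambda>t. k p (u t))"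
  shows "continuous_map T (pullback_topology D (\<lambda>x. \<lambda>p\<in>X. k p x) (product_topology (\<lambda>_. euclidean) X)) u"
proof (rule continuous_map_pullback')
  show "continuous_map T (product_topology (\<lambda>_. euclidean) X) ((\<lambda>x. \<lambda>p\<in>X. k p x) \<circ> u)"
    using assms(2) by (auto simp: continuous_map_componentwise)
qed (use assms(1) in auto)

lemma continuous_map_from_pullback:
  assumes "p \<in> X"
  shows "continuous_map (pullback_topology D (\<lambda>x. \<lambda>p\<in>X. k p x) (product_topology (\<lambda>_. euclidean) X)) euclidean (k p)"
  using continuous_map_pullback[OF continuous_map_product_coordinates[OF assms, of "\<lambda>_. euclidean"],
      of D "\<lambda>x. \<lambda>p\<in>X. k p x"] assms
  by (simp add: o_def)

text \<open>A maximal independent subfamily \<open>X'\<close> of the separating functionals is a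
  chart. In it the multiplication is given by structure constants, hence is polynomial and
  continuous.\<close>

lemma findim_wc_alg:
  fixes Q :: "('a, 'k::real_normed_field) alg" and X :: "'p set"
  assumes Q: "alg_ax Q" and X: "finite X" and lin: "\<forall>p\<in>X. linfun Q (k p)"
    and sep: "\<And>x. x \<in> vcar Q \<Longrightarrow> \<forall>p\<in>X. k p x = 0 \<Longrightarrow> x = vzero Q"
    and top: "vtop Q = pullback_topology (vcar Q) (\<lambda>x. \<lambda>p\<in>X. k p x) (product_topology (\<lambda>_. euclidean) X)"
  shows "wc_alg Q"
proof -
  have vsQ: "vs Q" using Q by (simp add: alg_ax_def)
  interpret vspace Q using vsQ by unfold_locales
  have ts: "topspace (vtop Q) = vcar Q"
    unfolding top topspace_pullback_topology by auto
  have sep2: "x = y" if "x \<in> vcar Q" "y \<in> vcar Q" "\<And>p. p \<in> X \<Longrightarrow> k p x = k p y" for x y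
  proof -
    have "\<forall>p\<in>X. k p (vsub Q x y) = 0" using that lin vsQ by (simp add: linfun_sub)
    from sep[OF sub_closed[OF that(1,2)] this] have "vsub Q x y = vzero Q" .
    then show ?thesis by (rule sub_eq_zeroD[OF that(1,2)])
  qed
  obtain X' s where D: "dual_family Q X k X' s" using dual_family_exists[OF vsQ X lin] by blast
  have X': "X' \<subseteq> X" "finite X'" and s: "\<And>p. p \<in> X' \<Longrightarrow> s p \<in> vcar Q"
    and delta: "\<And>p p'. p \<in> X' \<Longrightarrow> p' \<in> X' \<Longrightarrow> k p (s p') = (if p = p' then 1 else 0)"
    using D X finite_subset by (auto simp: dual_family_def)
  have expand: "l x = (\<Sum>p\<in>X'. k p x * l (s p))" if "linfun Q l" "x \<in> vcar Q" for l x
  proof -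
    have "l x = 0" if "x \<in> vcar Q" "\<forall>p\<in>X. k p x = 0" for x
      using sep[OF that] linfun_zero[OF vsQ \<open>linfun Q l\<close>] by simp
    then show ?thesis using D that unfolding dual_family_def by blast
  qed
  have kcont: "continuous_map (vtop Q) euclidean (k p)" if "p \<in> X" for p
    unfolding top using that by (rule continuous_map_from_pullback)
  have into: "continuous_map T (vtop Q) u" if "\<And>t. t \<in> topspace T \<Longrightarrow> u t \<in> vcar Q"
      "\<And>p. p \<in> X \<Longrightarrow> continuous_map T euclidean (\<lambda>t. k p (u t))" for T :: "'t topology" and u
    unfolding top using that by (rule continuous_map_into_pullback)
  have ax: "\<And>x y. x \<in> vcar Q \<Longrightarrow> y \<in> vcar Q \<Longrightarrow> amul Q x y \<in> vcar Q"
    "\<And>x y z. x \<in> vcar Q \<Longrightarrow> y \<in> vcar Q \<Longrightarrow> z \<in> vcar Q \<Longrightarrow>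
        amul Q (vadd Q x y) z = vadd Q (amul Q x z) (amul Q y z)"
    "\<And>x y z. x \<in> vcar Q \<Longrightarrow> y \<in> vcar Q \<Longrightarrow> z \<in> vcar Q \<Longrightarrow>
        amul Q z (vadd Q x y) = vadd Q (amul Q z x) (amul Q z y)"
    "\<And>c x y. x \<in> vcar Q \<Longrightarrow> y \<in> vcar Q \<Longrightarrow> amul Q (vsmul Q c x) y = vsmul Q c (amul Q x y)"
    "\<And>c x y. x \<in> vcar Q \<Longrightarrow> y \<in> vcar Q \<Longrightarrow> amul Q x (vsmul Q c y) = vsmul Q c (amul Q x y)"
    using Q unfolding alg_ax_def by blast+
  \<comment> \<open>Expanding first in \<open>x\<close> and then in \<open>y\<close>; the values of
    \<open>k p\<close> on products of dual vectors are the structure constants.\<close>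
  have bil: "k p (amul Q x y) = (\<Sum>i\<in>X'. k i x * (\<Sum>j\<in>X'. k j y * k p (amul Q (s i) (s j))))"
    if "p \<in> X" "x \<in> vcar Q" "y \<in> vcar Q" for p x y
  proof -
    have kp: "linfun Q (k p)" using lin that by blast
    have "linfun Q (\<lambda>x. k p (amul Q x y))" "\<And>z. z \<in> vcar Q \<Longrightarrow> linfun Q (\<lambda>y. k p (amul Q z y))"
      using that ax kp by (auto simp: linfun_def)
    then show ?thesis
      using expand[of "\<lambda>x. k p (amul Q x y)" x] expand[of "\<lambda>y. k p (amul Q (s i) y)" y for i] that s
      by simp
  qed
  have mult: "continuous_map (prod_topology (vtop Q) (vtop Q)) (vtop Q) (\<lambda>(x, y). amul Q x y)"
  proof (rule into)
    fix p assume p: "p \<in> X"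
    have "continuous_map (prod_topology (vtop Q) (vtop Q)) euclidean
      (\<lambda>t. \<Sum>i\<in>X'. k i (fst t) * (\<Sum>j\<in>X'. k j (snd t) * k p (amul Q (s i) (s j))))"
    proof (intro continuous_map_sum continuous_map_mult_field)
      show "continuous_map (prod_topology (vtop Q) (vtop Q)) euclidean (\<lambda>t. k i (fst t))" if "i \<in> X'" for i
        using continuous_map_compose[OF continuous_map_fst kcont] that X' by (auto simp: o_def)
      show "continuous_map (prod_topology (vtop Q) (vtop Q)) euclidean (\<lambda>t. k i (snd t))" if "i \<in> X'" for i
        using continuous_map_compose[OF continuous_map_snd kcont] that X' by (auto simp: o_def)
    qed (use X' in auto)
    then show "continuous_map (prod_topology (vtop Q) (vtop Q)) euclidean
        (\<lambda>t. k p (case t of (x, y) \<Rightarrow> amul Q x y))"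
      by (rule continuous_map_eq) (use bil p ts in auto)
  qed (use ts ax in auto)
  \<comment> \<open>The inverse of the chart. \<open>dual_family_surj\<close> provides a solution,
    and separation makes it unique, because the values on \<open>X'\<close> determine those on
    \<open>X\<close> through \<open>expand\<close>.\<close>
  define h where "h = (\<lambda>d. SOME x. x \<in> vcar Q \<and> (\<forall>p\<in>X'. k p x = d p))"
  have h: "h d \<in> vcar Q \<and> (\<forall>p\<in>X'. k p (h d) = d p)" for d
    unfolding h_def
    using someI_ex[of "\<lambda>x. x \<in> vcar Q \<and> (\<forall>p\<in>X'. k p x = d p)"] dual_family_surj[OF vsQ X'(2) _ D] lin X'(1)
    by blast
  have co: "coords Q X' (\<lambda>x. \<lambda>p\<in>X'. k p x)"
  proof (rule coordsI[OF ts])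
    show "continuous_map (product_topology (\<lambda>_. euclidean) X') (vtop Q) h"
    proof (rule into)
      fix p assume p: "p \<in> X"
      have "k p (h d) = (\<Sum>i\<in>X'. d i * k p (s i))" for d
        using expand[of "k p" "h d"] h[of d] p lin by simp
      then show "continuous_map (product_topology (\<lambda>_. euclidean) X') euclidean (\<lambda>d. k p (h d))"
        using X'(2) by (auto intro!: continuous_intros)
    qed (use h in auto)
    show "h (\<lambda>j\<in>X'. k j x) = x" if x: "x \<in> vcar Q" for x
    proof (rule sep2)
      fix p assume "p \<in> X"
      then show "k p (h (\<lambda>j\<in>X'. k j x)) = k p x"
        using expand[of "k p" "h (\<lambda>j\<in>X'. k j x)"] expand[of "k p" x] h[of "\<lambda>j\<in>X'. k j x"] lin x by simp
    qed (use h x in auto)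
  qed (use kcont lin X' h in auto)
  \<comment> \<open>The dual vectors serve as indices of the carrier type.\<close>
  have "inj_on s X'"
    using delta by (auto simp: inj_on_def) (metis zero_neq_one)
  from wc_algI[OF Q ts co this mult] show ?thesis .
qed

section \<open>Triple products and two-sided ideals of finite codimension\<close>

lemma alg_axD:
  assumes "alg_ax A"
  shows "vs A" "aone A \<in> vcar A"
    "\<And>x y. x \<in> vcar A \<Longrightarrow> y \<in> vcar A \<Longrightarrow> amul A x y \<in> vcar A"
    "\<And>x y z. x \<in> vcar A \<Longrightarrow> y \<in> vcar A \<Longrightarrow> z \<in> vcar A \<Longrightarrow> amul A (amul A x y) z = amul A x (amul A y z)"
    "\<And>x. x \<in> vcar A \<Longrightarrow> amul A (aone A) x = x"
    "\<And>x. x \<in> vcar A \<Longrightarrow> amul A x (aone A) = x"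
    "\<And>x y z. x \<in> vcar A \<Longrightarrow> y \<in> vcar A \<Longrightarrow> z \<in> vcar A \<Longrightarrow>
        amul A (vadd A x y) z = vadd A (amul A x z) (amul A y z)"
    "\<And>x y z. x \<in> vcar A \<Longrightarrow> y \<in> vcar A \<Longrightarrow> z \<in> vcar A \<Longrightarrow>
        amul A z (vadd A x y) = vadd A (amul A z x) (amul A z y)"
    "\<And>c x y. x \<in> vcar A \<Longrightarrow> y \<in> vcar A \<Longrightarrow> amul A (vsmul A c x) y = vsmul A c (amul A x y)"
    "\<And>c x y. x \<in> vcar A \<Longrightarrow> y \<in> vcar A \<Longrightarrow> amul A x (vsmul A c y) = vsmul A c (amul A x y)"
  using assms unfolding alg_ax_def by blast+

lemma wc_alg_mul_continuous:
  assumes "wc_alg A" "continuous_map T (vtop A) u" "continuous_map T (vtop A) v"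
  shows "continuous_map T (vtop A) (\<lambda>t. amul A (u t) (v t))"
proof -
  have "continuous_map (prod_topology (vtop A) (vtop A)) (vtop A) (\<lambda>(x, y). amul A x y)"
    using assms(1) by (simp add: wc_alg_def)
  from continuous_map_compose[OF continuous_map_pairedI[OF assms(2,3)] this]
  show ?thesis by (simp add: o_def)
qed

text \<open>The scalars sending \<open>x\<close> into \<open>W\<close> form an open set containing
  0, hence also a small nonzero real scalar.\<close>

lemma tvs_absorbing:
  assumes V: "tvs V" and W: "openin (vtop V) W" "vzero V \<in> W" and x: "x \<in> vcar V"
  shows "\<exists>s. s \<noteq> 0 \<and> vsmul V s x \<in> W"
proof -
  interpret vspace V using V by unfold_locales (simp add: tvs_def)
  have ts: "topspace (vtop V) = vcar V" using V by (simp add: tvs_def)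
  have "continuous_map (prod_topology euclidean (vtop V)) (vtop V) (\<lambda>(c, x). vsmul V c x)"
    using V by (simp add: tvs_def)
  moreover have "continuous_map euclidean (prod_topology euclidean (vtop V)) (\<lambda>c. (c, x))"
    using x ts by (intro continuous_map_pairedI) auto
  ultimately have "continuous_map euclidean (vtop V) (\<lambda>c. vsmul V c x)"
    using continuous_map_compose by (force simp: o_def)
  from openin_continuous_map_preimage[OF this W(1)]
  have "open {c. vsmul V c x \<in> W}" by simp
  moreover have "0 \<in> {c. vsmul V c x \<in> W}" using x W by simp
  ultimately obtain e where e: "e > 0" "ball 0 e \<subseteq> {c. vsmul V c x \<in> W}"
    using open_contains_ball by blast
  have "of_real (e / 2) \<in> ball (0 :: 'b) e" using e by (simp del: of_real_divide)
  then have "vsmul V (of_real (e / 2)) x \<in> W" using e(2) by blast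
  moreover have "of_real (e / 2) \<noteq> (0 :: 'b)" using e(1) by simp
  ultimately show ?thesis by blast
qed

text \<open>Every neighbourhood of zero contains a subspace of finite codimension given by coordinates, on
which a form bounded near zero must vanish.\<close>

lemma triple_product_finite_support:
  fixes A :: "('a, 'k::real_normed_field) alg"
  assumes A: "wc_alg A" and co: "coords A J f" and j: "j \<in> J"
  shows "\<exists>G\<subseteq>J. finite G \<and> (\<forall>a\<in>vcar A. \<forall>x\<in>vcar A. \<forall>b\<in>vcar A.
     (\<forall>i\<in>G. f a i = 0) \<or> (\<forall>i\<in>G. f b i = 0) \<longrightarrow> f (amul A (amul A a x) b) j = 0)"
proof -
  note ts = wc_alg_topspace[OF A] and ax = alg_axD[OF wc_alg_alg_ax[OF A]]
  interpret vspace A using ax(1) by unfold_locales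
  have tvs: "tvs A" using A by (simp add: wc_alg_def wcs_def)
  let ?T = "vtop A"
  let ?P = "prod_topology ?T (prod_topology ?T ?T)"
  define m where "m = (\<lambda>a x b. f (amul A (amul A a x) b) j)"
  have lin: "linfun A (\<lambda>x. f x j)" using coords_linfun[OF co j] .
  have "continuous_map ?P ?T (\<lambda>t. amul A (amul A (fst t) (fst (snd t))) (snd (snd t)))"
    using continuous_map_compose[OF continuous_map_snd continuous_map_fst, of ?T ?T ?T]
      continuous_map_compose[OF continuous_map_snd continuous_map_snd, of ?T ?T ?T]
    by (intro wc_alg_mul_continuous[OF A] continuous_map_fst) (simp_all add: o_def)
  from continuous_map_compose[OF this coords_continuous[OF co j]]
  have "continuous_map ?P euclidean (\<lambda>t. m (fst t) (fst (snd t)) (snd (snd t)))"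
    by (simp add: o_def m_def)
  from openin_continuous_map_preimage[OF this, of "ball 0 1"]
  have W: "openin ?P {t \<in> topspace ?P. norm (m (fst t) (fst (snd t)) (snd (snd t))) < 1}" (is "openin _ ?W")
    by simp
  have z0: "m (vzero A) (vzero A) (vzero A) = 0"
  proof -
    have "amul A (vzero A) x = vzero A" if "x \<in> vcar A" for x
      using ax(9)[OF that that, of 0] ax(3)[OF that that] that by simp
    then show ?thesis using linfun_zero[OF ax(1) lin] by (simp add: m_def)
  qed
  then have "(vzero A, (vzero A, vzero A)) \<in> ?W" using ts by simp
  from iffD1[OF openin_prod_topology_alt W, rule_format, OF this]
  obtain U V where U: "openin ?T U" "openin (prod_topology ?T ?T) V" "vzero A \<in> U"
    "(vzero A, vzero A) \<in> V" "U \<times> V \<subseteq> ?W"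
    by (elim exE conjE)
  from iffD1[OF openin_prod_topology_alt U(2), rule_format, OF U(4)]
  obtain V1 V2 where V: "openin ?T V1" "openin ?T V2" "vzero A \<in> V1" "vzero A \<in> V2" "V1 \<times> V2 \<subseteq> V"
    by (elim exE conjE)
  define W0 where "W0 = U \<inter> (V1 \<inter> V2)"
  have W0: "openin ?T W0" "vzero A \<in> W0" using U V by (auto simp: W0_def)
  have small: "norm (m a x b) < 1" if "a \<in> W0" "x \<in> W0" "b \<in> W0" for a x b
  proof -
    have "(a, (x, b)) \<in> U \<times> V" using that V(5) by (auto simp: W0_def)
    then have "(a, (x, b)) \<in> ?W" using U(5) by blast
    then show ?thesis by simp
  qed
  obtain G where G: "G \<subseteq> J" "finite G" "\<And>y. y \<in> vcar A \<Longrightarrow> \<forall>i\<in>G. f y i = f (vzero A) i \<Longrightarrow> y \<in> W0"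
    using coords_nbhd[OF co ts W0] by blast
  have linG: "linfun A (\<lambda>x. f x i)" if "i \<in> G" for i using coords_linfun[OF co] G(1) that by blast
  \<comment> \<open>The vectors vanishing on \<open>G\<close> form a subspace inside
    \<open>W0\<close>, so the bound survives arbitrary scaling.\<close>
  have null: "vsmul A t y \<in> W0" if "y \<in> vcar A" "\<forall>i\<in>G. f y i = 0" for t y
    using that linfun_smul[OF linG] linfun_zero[OF ax(1) linG] by (intro G(3)) auto
  have scale: "m (vsmul A t a) (vsmul A s x) (vsmul A u b) = t * s * u * m a x b"
    if "a \<in> vcar A" "x \<in> vcar A" "b \<in> vcar A" for t s u a x b
    unfolding m_def using that ax(3,9,10) linfun_smul[OF lin] by (simp add: smul_smul)
  \<comment> \<open>If \<open>m a x b\<close> were nonzero, the free scalar \<open>t\<close> could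
    be chosen so that the scaled value is exactly 1, against the bound.\<close>
  have key: "m a x b = 0"
    if abx: "a \<in> vcar A" "x \<in> vcar A" "b \<in> vcar A" and s: "s \<noteq> 0" "u \<noteq> 0" "v \<noteq> 0"
      and w: "\<And>t. norm (m (vsmul A (t * s) a) (vsmul A u x) (vsmul A v b)) < 1" for a x b s u v
  proof (rule ccontr)
    assume n: "m a x b \<noteq> 0"
    have "norm ((1 / (s * u * v * m a x b)) * s * u * v * m a x b) < 1"
      using w[of "1 / (s * u * v * m a x b)"] unfolding scale[OF abx] by (simp add: mult.assoc)
    moreover have "(1 / (s * u * v * m a x b)) * s * u * v * m a x b = 1" using n s by simp
    ultimately show False by simp
  qed
  show ?thesis
  proof (intro exI[of _ G] conjI ballI impI)
    fix a x b assume abx: "a \<in> vcar A" "x \<in> vcar A" "b \<in> vcar A"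
      and nul: "(\<forall>i\<in>G. f a i = 0) \<or> (\<forall>i\<in>G. f b i = 0)"
    obtain s u v where s: "s \<noteq> 0" "vsmul A s a \<in> W0" "u \<noteq> 0" "vsmul A u x \<in> W0" "v \<noteq> 0" "vsmul A v b \<in> W0"
      using tvs_absorbing[OF tvs W0] abx by metis
    have "m a x b = 0"
      using nul
    proof
      assume "\<forall>i\<in>G. f a i = 0"
      then show ?thesis using abx s null small by (intro key[of a x b 1 u v]) auto
    next
      assume b0: "\<forall>i\<in>G. f b i = 0"
      show ?thesis
      proof (rule key[of a x b s u 1])
        fix t
        \<comment> \<open>By trilinearity the free scalar moves from the first factor to the third,
          the one that may be scaled without leaving \<open>W0\<close>.\<close>
        have "m (vsmul A (t * s) a) (vsmul A u x) (vsmul A 1 b) = m (vsmul A s a) (vsmul A u x) (vsmul A t b)"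
          unfolding scale[OF abx] by simp
        then show "norm (m (vsmul A (t * s) a) (vsmul A u x) (vsmul A 1 b)) < 1"
          using small s null[OF abx(3) b0] by simp
      qed (use abx s in auto)
    qed
    then show "f (amul A (amul A a x) b) j = 0" by (simp add: m_def)
  qed (use G in auto)
qed

text \<open>The quotient by the common kernel of the functionals \<open>k\<close> is carried by representatives
selected by \<open>r\<close>, so that it lives on the same type as the algebra itself.\<close>

definition rep_alg :: "('a, 'k::real_normed_field) alg \<Rightarrow> ('a \<Rightarrow> 'a) \<Rightarrow> 'p set \<Rightarrow> ('p \<Rightarrow> 'a \<Rightarrow> 'k)
    \<Rightarrow> 'a set \<Rightarrow> ('a, 'k) alg" where
  "rep_alg A r X k S = \<lparr> vcar = r ` S, vadd = (\<lambda>x y. r (vadd A x y)), vzero = r (vzero A),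
     vsmul = (\<lambda>c x. r (vsmul A c x)),
     vtop = pullback_topology (r ` S) (\<lambda>x. \<lambda>p\<in>X. k p x) (product_topology (\<lambda>_. euclidean) X),
     amul = (\<lambda>x y. r (amul A x y)), aone = r (aone A) \<rparr>"

text \<open>The assumption \<open>k_mul\<close> says that congruence modulo the common kernel
  respects products, that is, the kernel is a two-sided ideal. By \<open>k_r\<close> and
  \<open>r_cong\<close> the map \<open>r\<close> is a normal form: it stays in its class and depends
  only on the class.\<close>

locale rep_quot =
  fixes A :: "('a, 'k::real_normed_field) alg" and r :: "'a \<Rightarrow> 'a" and X :: "'p set" and k :: "'p \<Rightarrow> 'a \<Rightarrow> 'k"
  assumes A: "alg_ax A" and X: "finite X" and lin: "\<And>p. p \<in> X \<Longrightarrow> linfun A (k p)"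
    and r_closed: "\<And>x. x \<in> vcar A \<Longrightarrow> r x \<in> vcar A"
    and k_r: "\<And>x p. x \<in> vcar A \<Longrightarrow> p \<in> X \<Longrightarrow> k p (r x) = k p x"
    and r_cong: "\<And>x y. x \<in> vcar A \<Longrightarrow> y \<in> vcar A \<Longrightarrow> (\<And>p. p \<in> X \<Longrightarrow> k p x = k p y) \<Longrightarrow> r x = r y"
    and k_mul: "\<And>x x' y y' p. \<lbrakk>x \<in> vcar A; x' \<in> vcar A; y \<in> vcar A; y' \<in> vcar A;
       \<And>p. p \<in> X \<Longrightarrow> k p x = k p x'; \<And>p. p \<in> X \<Longrightarrow> k p y = k p y'; p \<in> X\<rbrakk>
       \<Longrightarrow> k p (amul A x y) = k p (amul A x' y')"
begin

sublocale vspace A using A by unfold_locales (simp add: alg_ax_def)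

lemma r_add: "x \<in> vcar A \<Longrightarrow> y \<in> vcar A \<Longrightarrow> r (vadd A (r x) (r y)) = r (vadd A x y)"
  using linfun_add[OF lin] k_r r_closed by (intro r_cong) auto

lemma r_smul: "x \<in> vcar A \<Longrightarrow> r (vsmul A c (r x)) = r (vsmul A c x)"
  using linfun_smul[OF lin] k_r r_closed by (intro r_cong) auto

lemma r_mul: "x \<in> vcar A \<Longrightarrow> y \<in> vcar A \<Longrightarrow> r (amul A (r x) (r y)) = r (amul A x y)"
  using k_r r_closed alg_axD(3)[OF A] by (intro r_cong k_mul) auto

text \<open>The functionals still separate the points of the image of \<open>S\<close>, which is all
  that \<open>findim_wc_alg\<close> needs besides the algebra laws and linearity; so subalgebras of
  the quotient are weakly complete too.\<close>

lemma wc_alg_rep_alg: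
  assumes S: "subalg A S"
  shows "wc_alg (rep_alg A r X k S)"
proof -
  have sub: "x \<in> vcar A" if "x \<in> S" for x using S that by (auto simp: subalg_def subspc_def)
  have ax: "alg_ax (rep_alg A r X k S)"
    by (rule alg_ax_image[OF A S, where q = r]) (auto simp: rep_alg_def r_add r_smul r_mul sub)
  show ?thesis
  proof (rule findim_wc_alg[OF ax X, where k = k])
    show "\<forall>p\<in>X. linfun (rep_alg A r X k S) (k p)"
      using linfun_add[OF lin] linfun_smul[OF lin] k_r r_closed sub
      by (auto simp: linfun_def rep_alg_def)
    fix x assume x: "x \<in> vcar (rep_alg A r X k S)" "\<forall>p\<in>X. k p x = 0"
    then obtain y where y: "x = r y" "y \<in> vcar A" using sub by (auto simp: rep_alg_def)
    have "r y = r (vzero A)"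
      using y x linfun_zero[OF vs lin] k_r by (intro r_cong) auto
    then show "x = vzero (rep_alg A r X k S)" using y by (simp add: rep_alg_def)
  qed (simp add: rep_alg_def)
qed

lemma alg_hom_rep_alg:
  assumes "topspace (vtop A) = vcar A" "\<And>p. p \<in> X \<Longrightarrow> continuous_map (vtop A) euclidean (k p)"
  shows "alg_hom A (rep_alg A r X k (vcar A)) r"
  unfolding alg_hom_def
proof (intro conjI)
  show "linmap A (rep_alg A r X k (vcar A)) r"
    by (auto simp: linmap_def rep_alg_def r_add r_smul)
  show "continuous_map (vtop A) (vtop (rep_alg A r X k (vcar A))) r"
    unfolding rep_alg_def tvs.simps
  proof (rule continuous_map_into_pullback)
    fix p assume p: "p \<in> X"
    show "continuous_map (vtop A) euclidean (\<lambda>x. k p (r x))"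
      by (rule continuous_map_eq[OF assms(2)[OF p]]) (use k_r p assms(1) in auto)
  qed (use assms in auto)
qed (auto simp: rep_alg_def r_mul)

lemma vtop_rep_alg_sub:
  assumes "S \<subseteq> vcar A"
  shows "vtop (rep_alg A r X k S) = subtopology (vtop (rep_alg A r X k (vcar A))) (vcar (rep_alg A r X k S))"
  unfolding topology_eq openin_subtopology using assms
  by (auto simp: rep_alg_def openin_pullback_topology)

end

text \<open>The ideal divided out consists of the \<open>x\<close> with \<open>f (axb) j = 0\<close>
  for all \<open>a\<close>, \<open>b\<close> and all \<open>j\<close> in \<open>F\<close>. Besides
  the quotient \<open>Q\<close>, the image \<open>R\<close> of \<open>S\<close> is provided as a
  test algebra in its own right, sharing the operations of \<open>Q\<close>. The last clause lets
  the coordinates in \<open>F\<close> descend to \<open>Q\<close>.\<close>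

lemma finite_dim_quotient:
  fixes A :: "('a, 'k::real_normed_field) alg" and J :: "'i set"
  assumes wcA: "wc_alg A" and co: "coords A J f" and F: "finite F" "F \<subseteq> J" and S: "subalg A S"
  shows "\<exists>(Q :: ('a, 'k) alg) (R :: ('a, 'k) alg) q (X :: ('i \<times> 'i \<times> 'i) set) k.
    wc_alg Q \<and> wc_alg R \<and> alg_hom A Q q \<and> vcar R = q ` S \<and> 
    vtop R = subtopology (vtop Q) (vcar R) \<and> vadd R = vadd Q \<and> vsmul R = vsmul Q \<and> vzero R = vzero Q \<and>
    amul R = amul Q \<and> aone R = aone Q \<and>
    finite X \<and> (\<forall>p\<in>X. linfun Q (k p)) \<and>
    (\<forall>x\<in>vcar Q. (\<forall>p\<in>X. k p x = 0) \<longrightarrow> x = vzero Q) \<and>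
    (\<forall>j\<in>F. \<exists>l. continuous_map (vtop Q) euclidean l \<and> (\<forall>x\<in>vcar A. l (q x) = f x j))"
proof -
  note ts = wc_alg_topspace[OF wcA] and aA = wc_alg_alg_ax[OF wcA] and ax = alg_axD[OF wc_alg_alg_ax[OF wcA]]
  have "\<forall>j\<in>F. \<exists>G\<subseteq>J. finite G \<and> (\<forall>a\<in>vcar A. \<forall>x\<in>vcar A. \<forall>b\<in>vcar A.
     (\<forall>i\<in>G. f a i = 0) \<or> (\<forall>i\<in>G. f b i = 0) \<longrightarrow> f (amul A (amul A a x) b) j = 0)"
    using triple_product_finite_support[OF wcA co] F by blast
  then obtain G where G: "\<And>j. j \<in> F \<Longrightarrow> G j \<subseteq> J \<and> finite (G j) \<and> (\<forall>a\<in>vcar A. \<forall>x\<in>vcar A. \<forall>b\<in>vcar A.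
     (\<forall>i\<in>G j. f a i = 0) \<or> (\<forall>i\<in>G j. f b i = 0) \<longrightarrow> f (amul A (amul A a x) b) j = 0)"
    by metis
  define H where "H = (\<Union>j\<in>F. G j)"
  have H: "H \<subseteq> J" "finite H" using G F(1) unfolding H_def by blast+
  have left0: "f (amul A (amul A a x) b) j = 0"
    if "a \<in> vcar A" "x \<in> vcar A" "b \<in> vcar A" "j \<in> F" "\<forall>i\<in>H. f a i = 0" for a x b j
    using G[OF that(4)] that by (auto simp: H_def)
  have right0: "f (amul A (amul A a x) b) j = 0"
    if "a \<in> vcar A" "x \<in> vcar A" "b \<in> vcar A" "j \<in> F" "\<forall>i\<in>H. f b i = 0" for a x b j
    using G[OF that(4)] that by (auto simp: H_def)
  have flin: "linfun A (\<lambda>x. f x j)" if "j \<in> J" for j using coords_linfun[OF co that] .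
  obtain H' e where D: "dual_family A H (\<lambda>i x. f x i) H' e"
    using dual_family_exists[OF ax(1) H(2), of "\<lambda>i x. f x i"] flin H(1) by blast
  have H': "finite H'" and e: "\<And>i. i \<in> H' \<Longrightarrow> e i \<in> vcar A"
    using D H(2) finite_subset by (auto simp: dual_family_def)
  have expand: "l x = (\<Sum>i\<in>H'. f x i * l (e i))"
    if "linfun A l" "\<And>x. x \<in> vcar A \<Longrightarrow> \<forall>i\<in>H. f x i = 0 \<Longrightarrow> l x = 0" "x \<in> vcar A" for l x
    using D that unfolding dual_family_def by blast
  \<comment> \<open>A triple \<open>(i, i', j)\<close> stands for the functional sending
    \<open>x\<close> to coordinate \<open>j\<close> of \<open>e i\<close> times \<open>x\<close>
    times \<open>e i'\<close>.\<close>
  define X where "X = H' \<times> H' \<times> F"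
  define k where "k = (\<lambda>(i, i', j) x. f (amul A (amul A (e i) x) (e i')) j)"
  have k_eq: "k (i, i', j) x = f (amul A (amul A (e i) x) (e i')) j" for i i' j x by (simp add: k_def)
  \<comment> \<open>Expansion in the dual vectors, once in \<open>a\<close> and once in
    \<open>b\<close>. The vanishing that \<open>expand\<close> requires is \<open>left0\<close> and
    \<open>right0\<close>. So the finitely many \<open>k p\<close> control all triple
    products.\<close>
  have full: "f (amul A (amul A a x) b) j = (\<Sum>i\<in>H'. f a i * (\<Sum>i'\<in>H'. f b i' * k (i, i', j) x))"
    if "a \<in> vcar A" "x \<in> vcar A" "b \<in> vcar A" "j \<in> F" for a x b j
  proof -
    have jl: "linfun A (\<lambda>x. f x j)" using flin that F by blast
    have "f (amul A (amul A a x) b) j = (\<Sum>i\<in>H'. f a i * f (amul A (amul A (e i) x) b) j)"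
      using that ax left0 linfun_add[OF jl] linfun_smul[OF jl]
      by (intro expand[of "\<lambda>a. f (amul A (amul A a x) b) j"]) (auto simp: linfun_def)
    moreover have "f (amul A (amul A a x) b) j = (\<Sum>i\<in>H'. f b i * f (amul A (amul A a x) (e i)) j)"
      if "a \<in> vcar A" for a
      using that \<open>x \<in> vcar A\<close> \<open>b \<in> vcar A\<close> \<open>j \<in> F\<close> ax right0 linfun_add[OF jl] linfun_smul[OF jl]
      by (intro expand[of "\<lambda>b. f (amul A (amul A a x) b) j"]) (auto simp: linfun_def)
    ultimately show ?thesis using e by (simp add: k_eq)
  qed
  \<comment> \<open>The choice refers to \<open>x\<close> only through the values
    \<open>k p x\<close>, so congruent elements receive the same representative.\<close>
  define r where "r = (\<lambda>x. SOME y. y \<in> vcar A \<and> (\<forall>p\<in>X. k p y = k p x))"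
  have r: "r x \<in> vcar A \<and> (\<forall>p\<in>X. k p (r x) = k p x)" if "x \<in> vcar A" for x
    unfolding r_def by (rule someI[of _ x]) (use that in auto)
  have sep: "f (amul A (amul A a x) b) j = f (amul A (amul A a y) b) j"
    if "a \<in> vcar A" "x \<in> vcar A" "y \<in> vcar A" "b \<in> vcar A" "j \<in> F" "\<And>p. p \<in> X \<Longrightarrow> k p x = k p y" for a x y b j
    using that by (simp add: full X_def)
  interpret rep_quot A r X k
  proof unfold_locales
    show "finite X" using H' F by (simp add: X_def)
    show "linfun A (k p)" if pX: "p \<in> X" for p
    proof -
      obtain i i' j where p: "p = (i, i', j)" "i \<in> H'" "i' \<in> H'" "j \<in> J" using pX F by (auto simp: X_def)
      show ?thesis
        using p e ax linfun_add[OF flin[OF p(4)]] linfun_smul[OF flin[OF p(4)]]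
        by (auto simp: linfun_def k_eq)
    qed
    show "r x = r y" if "\<And>p. p \<in> X \<Longrightarrow> k p x = k p y" for x y
      unfolding r_def using that by simp
    fix x x' y y' p
    assume xy: "x \<in> vcar A" "x' \<in> vcar A" "y \<in> vcar A" "y' \<in> vcar A"
      and kk: "\<And>p. p \<in> X \<Longrightarrow> k p x = k p x'" "\<And>p. p \<in> X \<Longrightarrow> k p y = k p y'" and "p \<in> X"
    then obtain i i' j where p: "p = (i, i', j)" "i \<in> H'" "i' \<in> H'" "j \<in> F" by (auto simp: X_def)
    have ee: "e i \<in> vcar A" "e i' \<in> vcar A" using e p by auto
    \<comment> \<open>The factors are exchanged one at a time: \<open>y\<close> is absorbed into the
      right outer factor while \<open>x\<close> is replaced, then \<open>x'\<close> into the left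
      one while \<open>y\<close> is replaced.\<close>
    have "k p (amul A x y) = f (amul A (amul A (e i) x) (amul A y (e i'))) j"
      using p xy ee ax by (simp add: k_eq)
    also have "\<dots> = f (amul A (amul A (e i) x') (amul A y (e i'))) j"
      using kk(1) p ee xy ax by (intro sep) auto
    also have "\<dots> = f (amul A (amul A (amul A (e i) x') y) (e i')) j" using ee xy ax by simp
    also have "\<dots> = f (amul A (amul A (amul A (e i) x') y') (e i')) j"
      using kk(2) p ee xy ax by (intro sep) auto
    also have "\<dots> = k p (amul A x' y')" using p xy ee ax by (simp add: k_eq)
    finally show "k p (amul A x y) = k p (amul A x' y')" .
  qed (use r aA in auto)
  let ?Q = "rep_alg A r X k (vcar A)" and ?R = "rep_alg A r X k S"
  have kc: "continuous_map (vtop A) euclidean (k p)" if pX: "p \<in> X" for p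
  proof -
    obtain i i' j where p: "p = (i, i', j)" "i \<in> H'" "i' \<in> H'" "j \<in> J" using pX F by (auto simp: X_def)
    have "continuous_map (vtop A) (vtop A) (\<lambda>x. amul A (amul A (e i) x) (e i'))"
      using p e ts by (intro wc_alg_mul_continuous[OF wcA]) auto
    from continuous_map_compose[OF this coords_continuous[OF co p(4)]]
    show ?thesis using p by (simp add: o_def k_def)
  qed
  have kQ: "continuous_map (vtop ?Q) euclidean (k p)" if "p \<in> X" for p
    using continuous_map_from_pullback[OF that] by (simp add: rep_alg_def)
  have lQ: "linfun ?Q (k p)" if "p \<in> X" for p
    using linfun_add[OF lin[OF that]] linfun_smul[OF lin[OF that]] k_r r_closed that
    by (auto simp: linfun_def rep_alg_def)
  have "S \<subseteq> vcar A" "subalg A (vcar A)"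
    using S ax by (auto simp: subalg_def subspc_def)
  note wc = wc_alg_rep_alg[OF this(2)] and top = vtop_rep_alg_sub[OF this(1)]
  have s0: "x = vzero ?Q" if x: "x \<in> vcar ?Q" "\<forall>p\<in>X. k p x = 0" for x
  proof -
    obtain y where y: "y \<in> vcar A" "x = r y" using x by (auto simp: rep_alg_def)
    then have "r y = r (vzero A)" using x k_r linfun_zero[OF ax(1) lin] by (intro r_cong) auto
    then show ?thesis using y by (simp add: rep_alg_def)
  qed
  have coord: "\<exists>l. continuous_map (vtop ?Q) euclidean l \<and> (\<forall>x\<in>vcar A. l (r x) = f x j)" if j: "j \<in> F" for j
  proof (intro exI conjI ballI)
    \<comment> \<open>The formula \<open>full\<close> with both outer factors equal to the
      unit.\<close>
    let ?l = "\<lambda>x. \<Sum>i\<in>H'. f (aone A) i * (\<Sum>i'\<in>H'. f (aone A) i' * k (i, i', j) x)"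
    show "continuous_map (vtop ?Q) euclidean ?l"
      using kQ H' j by (intro continuous_map_sum continuous_map_mult_field) (auto simp: X_def)
    show "?l (r x) = f x j" if x: "x \<in> vcar A" for x
      using full[OF ax(2) r_closed[OF x] ax(2) j] sep[OF ax(2) r_closed[OF x] x ax(2) j] k_r[OF x] ax x by simp
  qed
  show ?thesis
    apply (rule exI[of _ ?Q], rule exI[of _ ?R], rule exI[of _ r], rule exI[of _ X], rule exI[of _ k])
    using wc wc_alg_rep_alg[OF S] alg_hom_rep_alg[OF ts kc] top X lQ s0 coord
    by (auto simp: rep_alg_def)
qed

lemma wc_alg_coords:
  fixes A :: "('a, 'k::real_normed_field) alg"
  assumes "wc_alg A"
  obtains J :: "'a set" and f where "coords A J f"
  using assms unfolding wc_alg_def wcs_def coords_def by blast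

lemma wc_alg_Hausdorff: "wc_alg A \<Longrightarrow> Hausdorff_space (vtop A)"
  by (erule wc_alg_coords) (rule coords_Hausdorff)

section \<open>Quotients of topological Lie algebras\<close>

lemma top_lieD:
  assumes "top_lie L"
  shows "vs L" "topspace (vtop L) = vcar L"
    "\<And>x y. x \<in> vcar L \<Longrightarrow> y \<in> vcar L \<Longrightarrow> lbr L x y \<in> vcar L"
    "\<And>x y z. x \<in> vcar L \<Longrightarrow> y \<in> vcar L \<Longrightarrow> z \<in> vcar L \<Longrightarrow> lbr L (vadd L x y) z = vadd L (lbr L x z) (lbr L y z)"
    "\<And>x y z. x \<in> vcar L \<Longrightarrow> y \<in> vcar L \<Longrightarrow> z \<in> vcar L \<Longrightarrow> lbr L z (vadd L x y) = vadd L (lbr L z x) (lbr L z y)"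
    "\<And>x. x \<in> vcar L \<Longrightarrow> lbr L x x = vzero L"
  using assms unfolding top_lie_def tvs_def by blast+

lemma Ideals_subspc: "I \<in> Ideals L \<Longrightarrow> subspc L I"
  by (simp add: Ideals_def closed_ideal_def subspc_def)

lemma Ideals_Int:
  assumes "top_lie L" "I \<in> Ideals L" "J \<in> Ideals L"
  shows "I \<inter> J \<in> Ideals L"
  using assms fin_codim_Int[OF top_lieD(1)[OF assms(1)] Ideals_subspc Ideals_subspc]
  by (auto simp: Ideals_def closed_ideal_def)

lemma Ideals_carrier:
  assumes "top_lie L"
  shows "vcar L \<in> Ideals L"
proof -
  note D = top_lieD[OF assms]
  interpret vspace L using D(1) by unfold_locales
  have "closedin (vtop L) (vcar L)" using closedin_topspace[of "vtop L"] D(2) by simp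
  then show ?thesis using D(3) fin_codim_carrier[OF D(1)] by (auto simp: Ideals_def closed_ideal_def)
qed

text \<open>Finite intersections stay in the family; the whole Lie algebra, with zero quotient,
  bounds the empty family.\<close>

lemma Ideals_finite_lower_bound:
  assumes "top_lie L" "finite \<F>" "\<F> \<subseteq> Ideals L"
  shows "\<exists>K\<in>Ideals L. \<forall>I\<in>\<F>. K \<subseteq> I"
  using assms(2,3)
proof (induction \<F>)
  case empty
  then show ?case using Ideals_carrier[OF assms(1)] by blast
next
  case (insert I \<F>)
  then obtain K where "K \<in> Ideals L" "\<forall>I\<in>\<F>. K \<subseteq> I" by auto
  then show ?case using Ideals_Int[OF assms(1), of I K] insert.prems by blast
qed

section \<open>Cosets modulo a closed ideal of finite codimension\<close>

locale lie_quotient =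
  fixes L :: "('a, 'k::real_normed_field) lie" and I :: "'a set"
  assumes lie: "top_lie L" and ideal: "I \<in> Ideals L"
begin

sublocale vspace L using top_lieD(1)[OF lie] by unfold_locales

lemma I_sub: "x \<in> I \<Longrightarrow> x \<in> vcar L"
  and I_zero: "vzero L \<in> I"
  and I_add: "x \<in> I \<Longrightarrow> y \<in> I \<Longrightarrow> vadd L x y \<in> I"
  and I_smul: "x \<in> I \<Longrightarrow> vsmul L c x \<in> I"
  and I_lbr_right: "x \<in> vcar L \<Longrightarrow> y \<in> I \<Longrightarrow> lbr L x y \<in> I"
  using ideal unfolding Ideals_def closed_ideal_def by blast+

text \<open>An ideal is only required to absorb brackets on one side. The other side follows from
  antisymmetry, obtained by expanding \<open>[x+y, x+y] = 0\<close>.\<close>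

lemma I_lbr_left:
  assumes "x \<in> I" "y \<in> vcar L"
  shows "lbr L x y \<in> I"
proof -
  note D = top_lieD[OF lie]
  have x: "x \<in> vcar L" using assms I_sub by blast
  have "lbr L (vadd L x y) (vadd L x y) = vadd L (lbr L x y) (lbr L y x)"
    using D(4)[of x y "vadd L x y"] D(5)[of x y x] D(5)[of x y y] D(6)[OF x] D(6)[OF assms(2)] D(3) x assms
    by simp
  then have "vadd L (lbr L x y) (lbr L y x) = vzero L"
    using x assms D(6)[of "vadd L x y"] by simp
  then have "lbr L x y = vsmul L (-1) (lbr L y x)"
    using sub_eq_zeroD[of "lbr L x y" "vsmul L (-1) (lbr L y x)"] x assms D(3)
    by (simp add: vsub_def smul_smul)
  then show ?thesis using assms I_lbr_right I_smul by simp
qed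

lemma coset_eq_iff:
  assumes "x \<in> vcar L" "y \<in> vcar L"
  shows "coset L I x = coset L I y \<longleftrightarrow> vsub L x y \<in> I"
proof
  assume "coset L I x = coset L I y"
  moreover have "x \<in> coset L I x" using assms I_zero by (simp add: coset_def)
  ultimately show "vsub L x y \<in> I" by (simp add: coset_def)
next
  assume xy: "vsub L x y \<in> I"
  have yx: "vsub L y x \<in> I" using I_smul[OF xy, of "-1"] assms by (simp add: sub_swap)
  show "coset L I x = coset L I y"
    unfolding coset_def
    using assms sub_add_sub[of _ x y] sub_add_sub[of _ y x] I_add[OF _ xy] I_add[OF _ yx]
    by (auto; metis)
qed

lemma rep_coset:
  assumes "x \<in> vcar L"
  shows "rep (coset L I x) \<in> vcar L" "vsub L (rep (coset L I x)) x \<in> I"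
proof -
  have "x \<in> coset L I x" using assms I_zero by (simp add: coset_def)
  then have "rep (coset L I x) \<in> coset L I x" unfolding rep_def by (rule someI)
  then show "rep (coset L I x) \<in> vcar L" "vsub L (rep (coset L I x)) x \<in> I" by (auto simp: coset_def)
qed

lemma quot_add: "x \<in> vcar L \<Longrightarrow> y \<in> vcar L \<Longrightarrow>
    vadd (quot L I) (coset L I x) (coset L I y) = coset L I (vadd L x y)"
  using rep_coset I_add by (simp add: quot_def coset_eq_iff sub_add_distrib)

lemma quot_smul: "x \<in> vcar L \<Longrightarrow> vsmul (quot L I) c (coset L I x) = coset L I (vsmul L c x)"
  using rep_coset[of x] I_smul[of "vsub L (rep (coset L I x)) x" c]
  by (simp add: quot_def coset_eq_iff smul_sub_distrib)

lemma quot_lbr: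
  assumes "x \<in> vcar L" "y \<in> vcar L"
  shows "lbr (quot L I) (coset L I x) (coset L I y) = coset L I (lbr L x y)"
proof -
  note D = top_lieD[OF lie]
  define i j where "i = vsub L (rep (coset L I x)) x" and "j = vsub L (rep (coset L I y)) y"
  have ij: "i \<in> I" "j \<in> I" "i \<in> vcar L" "j \<in> vcar L" using rep_coset assms I_sub by (auto simp: i_def j_def)
  have r: "rep (coset L I x) = vadd L i x" "rep (coset L I y) = vadd L j y"
    using rep_coset assms sub_add_cancel by (auto simp: i_def j_def)
  \<comment> \<open>The error made by bracketing representatives instead of \<open>x\<close> and
    \<open>y\<close>; every summand has an entry in \<open>I\<close>.\<close>
  let ?u = "vadd L (vadd L (lbr L i j) (lbr L i y)) (lbr L x j)"
  have u: "?u \<in> I" using ij assms I_add I_lbr_left I_lbr_right by simp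
  have "lbr L (vadd L i x) (vadd L j y) = vadd L ?u (lbr L x y)"
    using ij assms D(3,4,5) by (simp add: add_ac)
  then have "vsub L (lbr L (vadd L i x) (vadd L j y)) (lbr L x y) = ?u"
    using add_sub_cancel[OF I_sub[OF u]] assms D(3) by simp
  then show ?thesis using u assms ij D(3) unfolding quot_def by (simp add: r coset_eq_iff)
qed

text \<open>The union of a set of cosets is its preimage under the quotient map, and preimages
  commute with unions and intersections; so the predicate in \<open>quot_top\<close> really is a
  topology.\<close>

lemma openin_quot:
  "openin (vtop (quot L I)) U \<longleftrightarrow> U \<subseteq> coset L I ` vcar L \<and> openin (vtop L) {x \<in> vcar L. coset L I x \<in> U}"
proof -
  have eq: "\<Union>U = {x \<in> vcar L. coset L I x \<in> U}" if U: "U \<subseteq> coset L I ` vcar L" for U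
  proof (intro set_eqI iffI)
    fix x assume "x \<in> \<Union>U"
    then obtain y where y: "y \<in> vcar L" "coset L I y \<in> U" "x \<in> coset L I y" using U by blast
    then have "x \<in> vcar L" "vsub L x y \<in> I" by (auto simp: coset_def)
    then have "x \<in> vcar L" "coset L I x = coset L I y" using y(1) by (auto simp: coset_eq_iff)
    then show "x \<in> {x \<in> vcar L. coset L I x \<in> U}" using y by simp
  next
    fix x assume x: "x \<in> {x \<in> vcar L. coset L I x \<in> U}"
    then have "x \<in> coset L I x" using I_zero by (simp add: coset_def)
    then show "x \<in> \<Union>U" using x by blast
  qed
  let ?P = "\<lambda>U. U \<subseteq> coset L I ` vcar L \<and> openin (vtop L) (\<Union>U)"
  let ?P' = "\<lambda>U. U \<subseteq> coset L I ` vcar L \<and> openin (vtop L) {x \<in> vcar L. coset L I x \<in> U}"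
  have PP: "?P = ?P'" using eq by (intro ext) auto
  have "istopology ?P'"
    unfolding istopology_def
  proof (intro conjI allI impI)
    fix S T assume "?P' S" "?P' T"
    then show "S \<inter> T \<subseteq> coset L I ` vcar L"
      and "openin (vtop L) {x \<in> vcar L. coset L I x \<in> S \<inter> T}"
      using openin_Int[of "vtop L" "{x \<in> vcar L. coset L I x \<in> S}" "{x \<in> vcar L. coset L I x \<in> T}"]
      by (auto simp: Int_def conj_ac elim!: back_subst[of "openin (vtop L)"])
  next
    fix \<K> assume K: "\<forall>K\<in>\<K>. ?P' K"
    then show "\<Union>\<K> \<subseteq> coset L I ` vcar L" by blast
    have "openin (vtop L) (\<Union>K\<in>\<K>. {x \<in> vcar L. coset L I x \<in> K})" using K by blast
    then show "openin (vtop L) {x \<in> vcar L. coset L I x \<in> \<Union>\<K>}"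
      by (rule back_subst[of "openin (vtop L)"]) auto
  qed
  then show ?thesis
    unfolding quot_def quot_top_def using PP by (simp add: topology_inverse')
qed

lemma topspace_quot: "topspace (vtop (quot L I)) = coset L I ` vcar L"
proof
  show "topspace (vtop (quot L I)) \<subseteq> coset L I ` vcar L"
    using openin_topspace[of "vtop (quot L I)"] openin_quot by blast
  have "{x \<in> vcar L. coset L I x \<in> coset L I ` vcar L} = topspace (vtop L)" using top_lieD(2)[OF lie] by auto
  then have "openin (vtop (quot L I)) (coset L I ` vcar L)" by (simp add: openin_quot)
  then show "coset L I ` vcar L \<subseteq> topspace (vtop (quot L I))" by (rule openin_subset)
qed

lemma lie_hom_proj: "lie_hom L (quot L I) (proj L I)"
  unfolding lie_hom_def linmap_def proj_def continuous_map
proof (intro conjI ballI allI impI)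
  show "openin (vtop L) {x \<in> topspace (vtop L). coset L I x \<in> U}" if "openin (vtop (quot L I)) U" for U
    using that top_lieD(2)[OF lie] by (simp add: openin_quot)
qed (use top_lieD(2)[OF lie] topspace_quot in \<open>auto simp: quot_add quot_smul quot_lbr\<close>, auto simp: quot_def)

text \<open>The quotient topology is final for the projection. This serves both the connecting maps
  between quotients and the factorization of a Lie morphism through its kernel.\<close>

lemma lie_hom_quot_lift:
  assumes k: "lie_hom L M k" and h: "\<And>x. x \<in> vcar L \<Longrightarrow> h (coset L I x) = k x"
  shows "lie_hom (quot L I) M h"
proof -
  note D = top_lieD[OF lie]
  have car: "vcar (quot L I) = coset L I ` vcar L" by (simp add: quot_def)
  have kk: "linmap L M k" "continuous_map (vtop L) (vtop M) k"
    "\<And>x y. x \<in> vcar L \<Longrightarrow> y \<in> vcar L \<Longrightarrow> k (lbr L x y) = lbr M (k x) (k y)"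
    using k by (auto simp: lie_hom_def)
  have "continuous_map (vtop (quot L I)) (vtop M) h"
    unfolding continuous_map_def
  proof (intro conjI allI impI)
    show "h \<in> topspace (vtop (quot L I)) \<rightarrow> topspace (vtop M)"
      using kk(2) h D(2) by (auto simp: topspace_quot continuous_map_def)
    fix U assume U: "openin (vtop M) U"
    have "{x \<in> vcar L. coset L I x \<in> {X \<in> topspace (vtop (quot L I)). h X \<in> U}} = {x \<in> topspace (vtop L). k x \<in> U}"
      using h D(2) by (auto simp: topspace_quot)
    then show "openin (vtop (quot L I)) {X \<in> topspace (vtop (quot L I)). h X \<in> U}"
      using openin_continuous_map_preimage[OF kk(2) U] by (auto simp: openin_quot topspace_quot)
  qed
  then show ?thesis
    using kk h D(3) unfolding lie_hom_def linmap_def car ball_simps(9)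
    by (auto simp: quot_add quot_smul quot_lbr)
qed

lemma projIJ_coset:
  assumes "I' \<in> Ideals L" "I \<subseteq> I'" "x \<in> vcar L"
  shows "projIJ L I' (coset L I x) = coset L I' x"
proof -
  interpret Q: lie_quotient L I' using lie assms(1) by unfold_locales
  show ?thesis unfolding projIJ_def using rep_coset[OF assms(3)] assms by (simp add: Q.coset_eq_iff subset_iff)
qed

end

section \<open>Enveloping algebras\<close>

lemma comm_lie_simps [simp]:
  "vcar (comm_lie A) = vcar A" "vadd (comm_lie A) = vadd A" "vzero (comm_lie A) = vzero A"
  "vsmul (comm_lie A) = vsmul A" "vtop (comm_lie A) = vtop A"
  "lbr (comm_lie A) x y = vsub A (amul A x y) (amul A y x)"
  by (simp_all add: comm_lie_def)

lemma alg_homD: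
  assumes "alg_hom A B h"
  shows "\<And>x. x \<in> vcar A \<Longrightarrow> h x \<in> vcar B"
    "\<And>x y. x \<in> vcar A \<Longrightarrow> y \<in> vcar A \<Longrightarrow> h (vadd A x y) = vadd B (h x) (h y)"
    "\<And>c x. x \<in> vcar A \<Longrightarrow> h (vsmul A c x) = vsmul B c (h x)"
    "\<And>x y. x \<in> vcar A \<Longrightarrow> y \<in> vcar A \<Longrightarrow> h (amul A x y) = amul B (h x) (h y)"
    "h (aone A) = aone B" "continuous_map (vtop A) (vtop B) h"
  using assms unfolding alg_hom_def linmap_def by blast+

lemma alg_hom_zero:
  assumes "alg_hom A B h" "vs A" "vs B"
  shows "h (vzero A) = vzero B"
proof -
  interpret A: vspace A using assms by unfold_locales
  interpret B: vspace B using assms by unfold_locales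
  have "h (vsmul A 0 (vzero A)) = vsmul B 0 (h (vzero A))" by (rule alg_homD(3)[OF assms(1) A.zero_closed])
  then show ?thesis using alg_homD(1)[OF assms(1)] by simp
qed

lemma alg_hom_compose:
  assumes "alg_hom A B h" "alg_hom B C k"
  shows "alg_hom A C (\<lambda>x. k (h x))"
proof -
  have "continuous_map (vtop A) (vtop C) (\<lambda>x. k (h x))"
    using continuous_map_compose[OF alg_homD(6)[OF assms(1)] alg_homD(6)[OF assms(2)]] by (simp add: o_def)
  then show ?thesis using alg_homD[OF assms(1)] alg_homD[OF assms(2)] by (simp add: alg_hom_def linmap_def)
qed

lemma alg_hom_id: "alg_hom A A (\<lambda>x. x)"
  by (simp add: alg_hom_def linmap_def)

lemma subalg_range:
  assumes h: "alg_hom A B h" and A: "alg_ax A" and B: "alg_ax B"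
  shows "subalg B (h ` vcar A)"
proof -
  note a = alg_axD[OF A] and hh = alg_homD[OF h]
  interpret vspace A using a(1) by unfold_locales
  have "vzero B \<in> h ` vcar A" using alg_hom_zero[OF h a(1) alg_axD(1)[OF B]] by (metis imageI zero_closed)
  moreover have "aone B \<in> h ` vcar A" using hh(5) a(2) by (metis imageI)
  ultimately show ?thesis
    using hh(1) a(3) unfolding subalg_def subspc_def
    by (auto simp: hh(2,3,4)[symmetric])
qed

lemma lie_hom_compose:
  assumes "lie_hom L M p" "lie_hom M N f"
  shows "lie_hom L N (\<lambda>x. f (p x))"
proof -
  have "continuous_map (vtop L) (vtop N) (\<lambda>x. f (p x))"
    using assms continuous_map_compose[of "vtop L" "vtop M" p "vtop N" f] by (simp add: lie_hom_def o_def)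
  then show ?thesis using assms by (simp add: lie_hom_def linmap_def)
qed

lemma lie_hom_alg_hom:
  assumes h: "alg_hom A B h" and A: "alg_ax A"
  shows "lie_hom (comm_lie A) (comm_lie B) h"
proof -
  note a = alg_axD[OF A]
  interpret vspace A using a(1) by unfold_locales
  show ?thesis using alg_homD[OF h] a(3) by (simp add: lie_hom_def linmap_def vsub_def)
qed

lemma WCE_extend:
  fixes U A :: "('u, 'k::real_normed_field) alg"
  assumes "WCE L U lam" "wc_alg A" "lie_hom L (comm_lie A) f"
  obtains h where "alg_hom U A h" "\<And>x. x \<in> vcar L \<Longrightarrow> h (lam x) = f x"
  using assms unfolding WCE_def by blast

lemma WCE_lie_hom: "WCE L U lam \<Longrightarrow> lie_hom L (comm_lie U) lam"
  and WCE_wc_alg: "WCE L U lam \<Longrightarrow> wc_alg U"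
  by (simp_all add: WCE_def)

text \<open>Both morphisms extend the same Lie morphism, so both equal the extension singled out by
  \<open>WCE\<close>.\<close>

lemma WCE_unique:
  fixes U A :: "('u, 'k::real_normed_field) alg"
  assumes W: "WCE L U lam" and A: "wc_alg A" and h: "alg_hom U A h" "alg_hom U A h'"
    and eq: "\<And>x. x \<in> vcar L \<Longrightarrow> h (lam x) = h' (lam x)" and u: "u \<in> vcar U"
  shows "h u = h' u"
proof -
  have "lie_hom L (comm_lie A) (\<lambda>x. h (lam x))"
    using lie_hom_compose[OF WCE_lie_hom[OF W] lie_hom_alg_hom[OF h(1) wc_alg_alg_ax[OF WCE_wc_alg[OF W]]]] .
  with W A have "\<exists>h0. alg_hom U A h0 \<and> (\<forall>x\<in>vcar L. h0 (lam x) = h (lam x)) \<and>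
      (\<forall>h'. alg_hom U A h' \<and> (\<forall>x\<in>vcar L. h' (lam x) = h (lam x)) \<longrightarrow> (\<forall>u\<in>vcar U. h' u = h0 u))"
    unfolding WCE_def by simp
  then obtain h0 where h0:
    "\<forall>h'. alg_hom U A h' \<and> (\<forall>x\<in>vcar L. h' (lam x) = h (lam x)) \<longrightarrow> (\<forall>u\<in>vcar U. h' u = h0 u)"
    by (elim exE conjE)
  have "h u = h0 u" using h0 h(1) u by simp
  moreover have "h' u = h0 u" using h0 h(2) eq u by simp
  ultimately show ?thesis by simp
qed

lemma Umap_spec:
  fixes U V :: "('u, 'k::real_normed_field) alg"
  assumes "WCE L U lam" "WCE M V mu" "lie_hom L M p"
  shows "alg_hom U V (Umap L U lam V mu p)" "\<And>x. x \<in> vcar L \<Longrightarrow> Umap L U lam V mu p (lam x) = mu (p x)"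
proof -
  have "lie_hom L (comm_lie V) (\<lambda>x. mu (p x))" using lie_hom_compose[OF assms(3) WCE_lie_hom[OF assms(2)]] .
  then obtain h where "alg_hom U V h \<and> (\<forall>x\<in>vcar L. h (lam x) = mu (p x))"
    using WCE_extend[OF assms(1) WCE_wc_alg[OF assms(2)]] by metis
  from someI[of "\<lambda>h. alg_hom U V h \<and> (\<forall>x\<in>vcar L. h (lam x) = mu (p x))", OF this]
  show "alg_hom U V (Umap L U lam V mu p)" "\<And>x. x \<in> vcar L \<Longrightarrow> Umap L U lam V mu p (lam x) = mu (p x)"
    unfolding Umap_def by blast+
qed

text \<open>The kernel is closed because \<open>Q\<close> is Hausdorff, and it has finite
  codimension because it is the common kernel of the finitely many functionals \<open>k p\<close>
  composed with \<phi>.\<close>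

lemma kernel_in_Ideals:
  assumes L: "top_lie L" and Q: "wc_alg Q" and \<phi>: "lie_hom L (comm_lie Q) \<phi>"
    and X: "finite X" "\<forall>p\<in>X. linfun Q (k p)" "\<forall>x\<in>vcar Q. (\<forall>p\<in>X. k p x = 0) \<longrightarrow> x = vzero Q"
  shows "{x \<in> vcar L. \<phi> x = vzero Q} \<in> Ideals L"
proof -
  note D = top_lieD[OF L] and a = alg_axD[OF wc_alg_alg_ax[OF Q]]
  interpret Q: vspace Q using a(1) by unfold_locales
  have f: "\<And>x. x \<in> vcar L \<Longrightarrow> \<phi> x \<in> vcar Q"
    "\<And>x y. x \<in> vcar L \<Longrightarrow> y \<in> vcar L \<Longrightarrow> \<phi> (vadd L x y) = vadd Q (\<phi> x) (\<phi> y)"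
    "\<And>c x. x \<in> vcar L \<Longrightarrow> \<phi> (vsmul L c x) = vsmul Q c (\<phi> x)"
    "\<And>x y. x \<in> vcar L \<Longrightarrow> y \<in> vcar L \<Longrightarrow> \<phi> (lbr L x y) = vsub Q (amul Q (\<phi> x) (\<phi> y)) (amul Q (\<phi> y) (\<phi> x))"
    "continuous_map (vtop L) (vtop Q) \<phi>"
    using \<phi> by (auto simp: lie_hom_def linmap_def)
  let ?I = "{x \<in> vcar L. \<phi> x = vzero Q}"
  have "linfun L (\<lambda>x. k p (\<phi> x))" if "p \<in> X" for p
    using X(2) that f(1,2,3) by (auto simp: linfun_def)
  then have *: "fin_codim L {x \<in> vcar L. \<forall>p\<in>X. k p (\<phi> x) = 0} \<and> subspc L {x \<in> vcar L. \<forall>p\<in>X. k p (\<phi> x) = 0}"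
    by (intro fin_codim_common_ker[OF D(1) X(1)]) auto
  have "{x \<in> vcar L. \<forall>p\<in>X. k p (\<phi> x) = 0} = ?I"
    using X(2,3) f(1) linfun_zero[OF a(1)] by auto
  note I = *[unfolded this]
  have z: "amul Q x (vzero Q) = vzero Q" "amul Q (vzero Q) x = vzero Q" if "x \<in> vcar Q" for x
    using a(9)[of "vzero Q" x 0] a(10)[of x "vzero Q" 0] a(3) that by auto
  have "closedin (vtop Q) {vzero Q}"
    using wc_alg_Hausdorff[OF Q] wc_alg_topspace[OF Q] by (simp add: closedin_Hausdorff_singleton)
  from closedin_continuous_map_preimage[OF f(5) this]
  have "closedin (vtop L) ?I" using D(2) by simp
  then show ?thesis
    using I D(3) f(1,4) z by (auto simp: Ideals_def closed_ideal_def subspc_def)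
qed

text \<open>A coordinate of the enveloping algebra factors through a finite-dimensional quotient, and the
Lie morphism into that quotient factors through \<open>L/I\<close> with \<open>I\<close> its kernel.\<close>

lemma coordinate_factors:
  fixes L :: "('a, 'k::real_normed_field) lie" and U :: "('u, 'k) alg" and J :: "'i set"
    and UQ :: "'a set \<Rightarrow> ('u, 'k) alg"
  assumes L: "top_lie L" and W: "WCE L U lam"
    and WQ: "\<And>I. I \<in> Ideals L \<Longrightarrow> WCE (quot L I) (UQ I) (lamQ I)"
    and co: "coords U J f" and j: "j \<in> J"
  shows "\<exists>I\<in>Ideals L. \<exists>\<psi>. continuous_map (vtop (UQ I)) euclidean \<psi> \<and>
    (\<forall>u\<in>vcar U. \<psi> (Umap L U lam (UQ I) (lamQ I) (proj L I) u) = f u j)"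
proof -
  note wcU = WCE_wc_alg[OF W]
  note aU = wc_alg_alg_ax[OF wcU]
  have "subalg U (vcar U)" using subalg_range[OF alg_hom_id aU aU] by simp
  from finite_dim_quotient[OF wcU co _ _ this, of "{j}"] j
  obtain Q :: "('u, 'k) alg" and q and X :: "('i \<times> 'i \<times> 'i) set" and k l where Q: "wc_alg Q" "alg_hom U Q q" "finite X" "\<forall>p\<in>X. linfun Q (k p)"
     "\<forall>x\<in>vcar Q. (\<forall>p\<in>X. k p x = 0) \<longrightarrow> x = vzero Q"
     and l: "continuous_map (vtop Q) euclidean l" "\<forall>x\<in>vcar U. l (q x) = f x j"
    by blast
  define \<phi> where "\<phi> = (\<lambda>x. q (lam x))"
  have \<phi>: "lie_hom L (comm_lie Q) \<phi>"
    unfolding \<phi>_def by (rule lie_hom_compose[OF WCE_lie_hom[OF W] lie_hom_alg_hom[OF Q(2) aU]])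
  define I where "I = {x \<in> vcar L. \<phi> x = vzero Q}"
  have I: "I \<in> Ideals L" unfolding I_def using kernel_in_Ideals[OF L Q(1) \<phi> Q(3-5)] .
  interpret lie_quotient L I using L I by unfold_locales
  interpret Q: vspace Q using alg_axD(1)[OF wc_alg_alg_ax[OF Q(1)]] by unfold_locales
  have \<phi>V: "\<And>x. x \<in> vcar L \<Longrightarrow> \<phi> x \<in> vcar Q"
    "\<And>x y. x \<in> vcar L \<Longrightarrow> y \<in> vcar L \<Longrightarrow> \<phi> (vsub L x y) = vsub Q (\<phi> x) (\<phi> y)"
    using \<phi> by (auto simp: lie_hom_def linmap_def vsub_def)
  \<comment> \<open>A representative differs from \<open>x\<close> by an element of
    \<open>I\<close>, the kernel of \<phi>.\<close>
  have rep: "\<phi> (rep (coset L I x)) = \<phi> x" if x: "x \<in> vcar L" for x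
  proof (rule Q.sub_eq_zeroD)
    show "vsub Q (\<phi> (rep (coset L I x))) (\<phi> x) = vzero Q"
      using rep_coset[OF x] x \<phi>V(2) unfolding I_def by simp
  qed (use \<phi>V rep_coset x in auto)
  have "lie_hom (quot L I) (comm_lie Q) (\<lambda>X. \<phi> (rep X))"
    by (rule lie_hom_quot_lift[OF \<phi>]) (rule rep)
  then obtain h where h: "alg_hom (UQ I) Q h" "\<And>X. X \<in> vcar (quot L I) \<Longrightarrow> h (lamQ I X) = \<phi> (rep X)"
    using WCE_extend[OF WQ[OF I] Q(1)] by metis
  let ?u = "Umap L U lam (UQ I) (lamQ I) (proj L I)"
  note us = Umap_spec[OF W WQ[OF I] lie_hom_proj]
  \<comment> \<open>Two morphisms out of \<open>U\<close> that agree on the image of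
    \<open>lam\<close>; the required \<psi> is then \<open>l\<close> after \<open>h\<close>.\<close>
  have "h (?u u) = q u" if "u \<in> vcar U" for u
  proof (rule WCE_unique[OF W Q(1) alg_hom_compose[OF us(1) h(1)] Q(2) _ that])
    fix x assume x: "x \<in> vcar L"
    then have "proj L I x \<in> vcar (quot L I)" by (simp add: proj_def quot_def)
    then show "h (?u (lam x)) = q (lam x)"
      using us(2)[OF x] h(2) rep[OF x] by (simp add: proj_def \<phi>_def)
  qed
  then have "\<forall>u\<in>vcar U. l (h (?u u)) = f u j" using l by simp
  moreover have "continuous_map (vtop (UQ I)) euclidean (\<lambda>u. l (h u))"
    using continuous_map_compose[OF alg_homD(6)[OF h(1)] l(1)] by (simp add: o_def)
  ultimately show ?thesis using I by blast
qed

text \<open>The image \<open>S\<close> of \<open>U\<close> contains the image of \<open>lamQ I\<close>; in every finite-dimensional quotient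
the universal property therefore takes values in the image of \<open>S\<close>.\<close>

lemma Umap_proj_dense:
  fixes L :: "('a, 'k::real_normed_field) lie" and U V :: "('u, 'k) alg"
  assumes L: "top_lie L" and W: "WCE L U lam" and I: "I \<in> Ideals L"
    and WQ: "WCE (quot L I) V mu"
    and T: "openin (vtop V) T" "v \<in> T"
  shows "\<exists>u\<in>vcar U. Umap L U lam V mu (proj L I) u \<in> T"
proof -
  interpret lie_quotient L I using L I by unfold_locales
  let ?u = "Umap L U lam V mu (proj L I)"
  note us = Umap_spec[OF W WQ lie_hom_proj]
  note wcV = WCE_wc_alg[OF WQ]
  note ts = wc_alg_topspace[OF wcV] and aV = wc_alg_alg_ax[OF wcV] and aU = wc_alg_alg_ax[OF WCE_wc_alg[OF W]]
  define S where "S = ?u ` vcar U"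
  have S: "subalg V S" unfolding S_def by (rule subalg_range[OF us(1) aU aV])
  obtain J :: "'u set" and f where co: "coords V J f" using wc_alg_coords[OF wcV] .
  obtain F where F: "F \<subseteq> J" "finite F" "\<And>y. y \<in> vcar V \<Longrightarrow> \<forall>j\<in>F. f y j = f v j \<Longrightarrow> y \<in> T"
    using coords_nbhd[OF co ts T] by blast
  from finite_dim_quotient[OF wcV co F(2,1) S]
  obtain Q R :: "('u, 'k) alg" and q where Q: "wc_alg Q" "wc_alg R" "alg_hom V Q q" "vcar R = q ` S"
     "vtop R = subtopology (vtop Q) (vcar R)" "vadd R = vadd Q" "vsmul R = vsmul Q" "vzero R = vzero Q"
     "amul R = amul Q" "aone R = aone Q"
     and l: "\<forall>j\<in>F. \<exists>l. continuous_map (vtop Q) euclidean l \<and> (\<forall>x\<in>vcar V. l (q x) = f x j)"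
    by (elim exE conjE) (rule that; assumption)
  have SV: "S \<subseteq> vcar V" using S by (simp add: subalg_def subspc_def)
  \<comment> \<open>The extension \<open>h\<close> below lands in \<open>R\<close> while
    \<open>q\<close> lands in \<open>Q\<close>; the inclusion makes them comparable by
    uniqueness.\<close>
  have incl: "alg_hom R Q (\<lambda>x. x)"
    using Q(3-10) alg_homD(1)[OF Q(3)] SV unfolding alg_hom_def linmap_def by auto
  have qm: "lie_hom (quot L I) (comm_lie Q) (\<lambda>X. q (mu X))"
    by (rule lie_hom_compose[OF WCE_lie_hom[OF WQ] lie_hom_alg_hom[OF Q(3) aV]])
  have inR: "q (mu X) \<in> vcar R" if X: "X \<in> vcar (quot L I)" for X
  proof -
    obtain x where x: "x \<in> vcar L" "X = proj L I x" using X by (auto simp: quot_def proj_def)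
    have "lam x \<in> vcar U" using WCE_lie_hom[OF W] x by (simp add: lie_hom_def linmap_def)
    then show ?thesis unfolding Q(4) S_def using us(2)[OF x(1)] x(2) by (metis imageI)
  qed
  have "lie_hom (quot L I) (comm_lie R) (\<lambda>X. q (mu X))"
    using qm inR Q(5-10) topspace_quot
    by (auto simp: lie_hom_def linmap_def vsub_def continuous_map_in_subtopology quot_def)
  then obtain h where h: "alg_hom V R h" "\<And>X. X \<in> vcar (quot L I) \<Longrightarrow> h (mu X) = q (mu X)"
    using WCE_extend[OF WQ Q(2)] by metis
  have v: "v \<in> vcar V" using T ts openin_subset by blast
  have "h v = q v"
    using WCE_unique[OF WQ Q(1) alg_hom_compose[OF h(1) incl] Q(3) _ v] h(2) by blast
  then have "q v \<in> q ` S" using alg_homD(1)[OF h(1) v] Q(4) by simp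
  then obtain u where u: "u \<in> vcar U" "q v = q (?u u)" by (auto simp: S_def)
  have uV: "?u u \<in> vcar V" using u SV by (auto simp: S_def)
  \<comment> \<open>The coordinates in \<open>F\<close> factor through \<open>q\<close>, so equality
    in \<open>Q\<close> forces agreement on \<open>F\<close>, which suffices to lie in
    \<open>T\<close>.\<close>
  have "f (?u u) j = f v j" if "j \<in> F" for j using l that u v uV by metis
  then show ?thesis using F(3)[OF uV] u by blast
qed

section \<open>The limit\<close>

text \<open>The map \<open>h'\<close> is assumed to be continuous only; it is a morphism because it
  inverts one. Preservation of zero is a separate assumption, since \<open>vzero B\<close> is not
  known to be neutral before the vector space laws of \<open>B\<close> are established.\<close>

lemma wc_alg_transport:
  fixes A :: "('u, 'k::real_normed_field) alg" and B :: "('b, 'k) alg" and \<iota> :: "'u \<Rightarrow> 'b"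
  assumes A: "wc_alg A" and h: "alg_hom A B h" and zero: "h (vzero A) = vzero B"
    and ts: "topspace (vtop B) = vcar B" and h': "continuous_map (vtop B) (vtop A) h'"
    and h'h: "\<And>x. x \<in> vcar A \<Longrightarrow> h' (h x) = x" and hh': "\<And>y. y \<in> vcar B \<Longrightarrow> h (h' y) = y"
    and \<iota>: "inj \<iota>"
  shows "wc_alg B" "alg_iso A B h"
proof -
  note a = alg_axD[OF wc_alg_alg_ax[OF A]] and tsA = wc_alg_topspace[OF A] and H = alg_homD[OF h]
  interpret vspace A using a(1) by unfold_locales
  have h'A: "h' y \<in> vcar A" if "y \<in> vcar B" for y
    using continuous_map_funspace[OF h'] that ts tsA by auto
  have car: "vcar B = h ` vcar A" using hh' h'A H(1) by (auto intro!: rev_image_eqI)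
  have sub: "subalg A (vcar A)" using a by (auto simp: subalg_def subspc_def)
  have axB: "alg_ax B"
    by (rule alg_ax_image[OF wc_alg_alg_ax[OF A] sub car]) (use H zero in auto)
  have h'_hom: "alg_hom B A h'"
    unfolding alg_hom_def linmap_def car ball_simps(9)
    using H a h' h'h by (simp add: H(2,3,4,5)[symmetric])
  then show "alg_iso A B h" using h h'h hh' unfolding alg_iso_def by blast
  obtain J :: "'u set" and f where co: "coords A J f" using wc_alg_coords[OF A] .
  obtain g where g: "continuous_map (product_topology (\<lambda>_. euclidean) J) (vtop A) g"
    "\<And>x. x \<in> vcar A \<Longrightarrow> g (f x) = x" "\<And>x. x \<in> vcar A \<Longrightarrow> f x \<in> extensional J"
    "\<And>d. d \<in> extensional J \<Longrightarrow> g d \<in> vcar A \<and> f (g d) = d"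
    using coords_inverse[OF co] tsA by metis
  have coB: "coords B J (\<lambda>y. \<lambda>j\<in>J. f (h' y) j)"
  proof (rule coordsI[OF ts])
    fix j assume j: "j \<in> J"
    show "continuous_map (vtop B) euclidean (\<lambda>y. f (h' y) j)"
      using continuous_map_compose[OF h' coords_continuous[OF co j]] by (simp add: o_def)
    show "linfun B (\<lambda>y. f (h' y) j)"
      using coords_linfun[OF co j] alg_homD(1-3)[OF h'_hom] by (simp add: linfun_def)
  next
    show "continuous_map (product_topology (\<lambda>_. euclidean) J) (vtop B) (\<lambda>d. h (g d))"
      using continuous_map_compose[OF g(1) H(6)] by (simp add: o_def)
    show "h (g (\<lambda>j\<in>J. f (h' y) j)) = y" if "y \<in> vcar B" for y
      using g(2,3)[OF h'A[OF that]] hh'[OF that] by (simp add: extensional_restrict)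
    show "f (h' (h (g d))) j = d j" if "d \<in> extensional J" "j \<in> J" for d j
      using g(4)[OF that(1)] h'h by simp
  qed
  have "continuous_map (prod_topology (vtop B) (vtop B)) (vtop B) (\<lambda>t. h (amul A (h' (fst t)) (h' (snd t))))"
    using continuous_map_compose[OF wc_alg_mul_continuous[OF A
        continuous_map_compose[OF continuous_map_fst h'] continuous_map_compose[OF continuous_map_snd h']] H(6)]
    by (simp add: o_def)
  then have "continuous_map (prod_topology (vtop B) (vtop B)) (vtop B) (\<lambda>(x, y). amul B x y)"
    by (rule continuous_map_eq) (use H(4) h'A hh' ts in auto)
  then show "wc_alg B" using wc_algI[OF axB ts coB inj_on_subset[OF \<iota> subset_UNIV]] by blast
qed

lemma lim_alg_simps:
  "vcar (lim_alg Idx le A tr) = {\<phi> \<in> (\<Pi>\<^sub>E i\<in>Idx. vcar (A i)). \<forall>i\<in>Idx. \<forall>j\<in>Idx. le j i \<longrightarrow> tr i j (\<phi> j) = \<phi> i}"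
  "vadd (lim_alg Idx le A tr) \<phi> \<psi> = (\<lambda>i\<in>Idx. vadd (A i) (\<phi> i) (\<psi> i))"
  "vzero (lim_alg Idx le A tr) = (\<lambda>i\<in>Idx. vzero (A i))"
  "vsmul (lim_alg Idx le A tr) c \<phi> = (\<lambda>i\<in>Idx. vsmul (A i) c (\<phi> i))"
  "vtop (lim_alg Idx le A tr) = subtopology (product_topology (\<lambda>i. vtop (A i)) Idx) (vcar (lim_alg Idx le A tr))"
  "amul (lim_alg Idx le A tr) \<phi> \<psi> = (\<lambda>i\<in>Idx. amul (A i) (\<phi> i) (\<psi> i))"
  "aone (lim_alg Idx le A tr) = (\<lambda>i\<in>Idx. aone (A i))"
  by (simp_all add: lim_alg_def Let_def)

theorem theorem1p10:
  fixes g :: "('a, 'k::real_normed_field) lie"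
    and Ug :: "('u, 'k) alg" and lamg :: "'a \<Rightarrow> 'u"
    and UQ :: "'a set \<Rightarrow> ('u, 'k) alg" and lamQ :: "'a set \<Rightarrow> 'a set \<Rightarrow> 'u"
  assumes "profinite g"
    and "WCE g Ug lamg"
    and "\<forall>I\<in>Ideals g. WCE (quot g I) (UQ I) (lamQ I)"
  defines "UP \<equiv> \<lambda>I J. Umap (quot g J) (UQ J) (lamQ J) (UQ I) (lamQ I) (projIJ g I)"
    and "\<omega> \<equiv> \<lambda>u. \<lambda>I\<in>Ideals g. Umap g Ug lamg (UQ I) (lamQ I) (proj g I) u"
  shows "(\<forall>I\<in>Ideals g. \<forall>J\<in>Ideals g. \<exists>K\<in>Ideals g. K \<subseteq> I \<and> K \<subseteq> J)
     \<and> (\<forall>I\<in>Ideals g. \<forall>J\<in>Ideals g. J \<subseteq> I \<longrightarrow> alg_hom (UQ J) (UQ I) (UP I J))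
     \<and> (\<forall>I\<in>Ideals g. \<forall>u\<in>vcar (UQ I). UP I I u = u)
     \<and> (\<forall>I\<in>Ideals g. \<forall>J\<in>Ideals g. \<forall>K\<in>Ideals g. K \<subseteq> J \<and> J \<subseteq> I \<longrightarrow>
          (\<forall>u\<in>vcar (UQ K). UP I J (UP J K u) = UP I K u))
     \<and> wc_alg (lim_alg (Ideals g) (\<subseteq>) UQ UP)
     \<and> alg_iso Ug (lim_alg (Ideals g) (\<subseteq>) UQ UP) \<omega>"
proof -
  have L: "top_lie g" using assms(1) by (simp add: profinite_def)
  note W = assms(2)
  have WQ: "WCE (quot g I) (UQ I) (lamQ I)" if "I \<in> Ideals g" for I using assms(3) that by blast
  have lq: "lie_quotient g I" if "I \<in> Ideals g" for I using L that by unfold_locales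
  have wcU: "wc_alg Ug" using WCE_wc_alg[OF W] .
  have wcQ: "wc_alg (UQ I)" if "I \<in> Ideals g" for I using WCE_wc_alg[OF WQ[OF that]] .
  define P where "P = (\<lambda>I. Umap g Ug lamg (UQ I) (lamQ I) (proj g I))"
  have P: "alg_hom Ug (UQ I) (P I)" "\<And>x. x \<in> vcar g \<Longrightarrow> P I (lamg x) = lamQ I (coset g I x)"
    if "I \<in> Ideals g" for I
    using Umap_spec[OF W WQ[OF that] lie_quotient.lie_hom_proj[OF lq[OF that]]] by (simp_all add: P_def proj_def)
  have UP: "alg_hom (UQ J) (UQ I) (UP I J)"
    "\<And>x. x \<in> vcar g \<Longrightarrow> UP I J (lamQ J (coset g J x)) = lamQ I (coset g I x)"
    if IJ: "I \<in> Ideals g" "J \<in> Ideals g" "J \<subseteq> I" for I J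
  proof -
    note pc = lie_quotient.projIJ_coset[OF lq[OF IJ(2)] IJ(1,3)]
    have "lie_hom (quot g J) (quot g I) (projIJ g I)"
      by (rule lie_quotient.lie_hom_quot_lift[OF lq[OF IJ(2)] lie_quotient.lie_hom_proj[OF lq[OF IJ(1)]]])
        (simp add: pc proj_def)
    note us = Umap_spec[OF WQ[OF IJ(2)] WQ[OF IJ(1)] this]
    show "alg_hom (UQ J) (UQ I) (UP I J)" using us(1) by (simp add: UP_def)
    show "UP I J (lamQ J (coset g J x)) = lamQ I (coset g I x)" if "x \<in> vcar g" for x
      using us(2)[of "coset g J x"] pc that by (simp add: UP_def quot_def)
  qed
  have car: "\<exists>x\<in>vcar g. X = coset g I x" if "X \<in> vcar (quot g I)" for X I using that by (auto simp: quot_def)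
  have id: "UP I I u = u" if I: "I \<in> Ideals g" and u: "u \<in> vcar (UQ I)" for I u
    using WCE_unique[OF WQ[OF I] wcQ[OF I] UP(1)[OF I I] alg_hom_id _ u] UP(2)[OF I I] car by force
  have comp: "UP I J (UP J K u) = UP I K u"
    if I: "I \<in> Ideals g" "J \<in> Ideals g" "K \<in> Ideals g" "K \<subseteq> J" "J \<subseteq> I" and u: "u \<in> vcar (UQ K)" for I J K u
  proof -
    have KI: "K \<subseteq> I" using I by blast
    show ?thesis
    proof (rule WCE_unique[OF WQ[OF I(3)] wcQ[OF I(1)]
          alg_hom_compose[OF UP(1)[OF I(2,3,4)] UP(1)[OF I(1,2,5)]] UP(1)[OF I(1,3) KI] _ u])
      fix X assume "X \<in> vcar (quot g K)"
      then obtain x where "x \<in> vcar g" "X = coset g K x" using car by blast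
      then show "UP I J (UP J K (lamQ K X)) = UP I K (lamQ K X)"
        using UP(2)[OF I(1,2,5)] UP(2)[OF I(2,3,4)] UP(2)[OF I(1,3) KI] by simp
    qed
  qed
  \<comment> \<open>Compatibility of the family \<open>P\<close>, which places the values of
    \<omega> inside the limit.\<close>
  have UPP: "UP I J (P J u) = P I u"
    if I: "I \<in> Ideals g" "J \<in> Ideals g" "J \<subseteq> I" and u: "u \<in> vcar Ug" for I J u
    by (rule WCE_unique[OF W wcQ[OF I(1)] alg_hom_compose[OF P(1)[OF I(2)] UP(1)[OF I]] P(1)[OF I(1)] _ u])
      (use P(2)[OF I(1)] P(2)[OF I(2)] UP(2)[OF I] in simp)
  define C where "C = lim_alg (Ideals g) (\<subseteq>) UQ UP"
  note lim = lim_alg_simps[of "Ideals g" "(\<subseteq>)" UQ UP, folded C_def]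
  have om: "\<omega> u = (\<lambda>I\<in>Ideals g. P I u)" for u by (simp add: \<omega>_def P_def)
  have tsC: "topspace (vtop C) = vcar C"
  proof -
    have "(\<Pi>\<^sub>E I\<in>Ideals g. topspace (vtop (UQ I))) = (\<Pi>\<^sub>E I\<in>Ideals g. vcar (UQ I))"
      using wc_alg_topspace[OF wcQ] by (intro PiE_cong)
    then show ?thesis unfolding lim(5) by (auto simp: lim(1))
  qed
  have pr: "continuous_map (vtop C) (vtop (UQ I)) (\<lambda>\<phi>. \<phi> I)" if "I \<in> Ideals g" for I
    unfolding lim(5) by (intro continuous_map_from_subtopology continuous_map_product_coordinates that)
  have omC: "\<omega> u \<in> vcar C" if "u \<in> vcar Ug" for u
    using that alg_homD(1)[OF P(1)] UPP by (auto simp: om lim(1))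
  have hom: "alg_hom Ug C \<omega>"
    unfolding alg_hom_def linmap_def
  proof (intro conjI ballI allI)
    have "continuous_map (vtop Ug) (product_topology (\<lambda>I. vtop (UQ I)) (Ideals g)) \<omega>"
      using alg_homD(6)[OF P(1)] by (auto simp: continuous_map_componentwise om)
    then show "continuous_map (vtop Ug) (vtop C) \<omega>"
      unfolding lim(5) using omC wc_alg_topspace[OF wcU] by (auto simp: continuous_map_in_subtopology)
  qed (use omC alg_homD[OF P(1)] in \<open>auto simp: om lim intro!: restrict_ext\<close>)
  have zero: "\<omega> (vzero Ug) = vzero C"
    unfolding om lim(3)
    using alg_hom_zero[OF P(1) alg_axD(1)[OF wc_alg_alg_ax[OF wcU]] alg_axD(1)[OF wc_alg_alg_ax[OF wcQ]]]
    by (auto intro!: restrict_ext)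
  obtain J :: "'u set" and f where co: "coords Ug J f" using wc_alg_coords[OF wcU] .
  note tsU = wc_alg_topspace[OF wcU]
  obtain h where h: "\<And>d. d \<in> extensional J \<Longrightarrow> h d \<in> vcar Ug \<and> f (h d) = d"
    using coords_inverse[OF co] tsU by metis
  have "\<forall>j\<in>J. \<exists>I \<psi>. I \<in> Ideals g \<and> continuous_map (vtop (UQ I)) euclidean \<psi> \<and> (\<forall>u\<in>vcar Ug. \<psi> (P I u) = f u j)"
    using coordinate_factors[OF L W WQ co] unfolding P_def by blast
  then obtain N \<psi> where N: "\<And>j. j \<in> J \<Longrightarrow> N j \<in> Ideals g"
    and \<psi>: "\<And>j. j \<in> J \<Longrightarrow> continuous_map (vtop (UQ (N j))) euclidean (\<psi> j)"
    "\<And>j u. j \<in> J \<Longrightarrow> u \<in> vcar Ug \<Longrightarrow> \<psi> j (P (N j) u) = f u j"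
    by metis
  \<comment> \<open>Any family of scalars indexed by \<open>J\<close> is the coordinate family of an
    element of \<open>Ug\<close>, so no compatibility between the choices of \<open>N\<close> and
    \<open>\<psi>\<close> is needed. Only the values on the image of \<omega> are prescribed by them
    directly.\<close>
  define \<theta> where "\<theta> = (\<lambda>\<phi>. h (\<lambda>j\<in>J. \<psi> j (\<phi> (N j))))"
  have \<theta>U: "\<theta> \<phi> \<in> vcar Ug" for \<phi> using h by (simp add: \<theta>_def)
  have f\<theta>: "f (\<theta> \<phi>) j = \<psi> j (\<phi> (N j))" if "j \<in> J" for \<phi> j using h that by (simp add: \<theta>_def)
  have \<theta>_cont: "continuous_map (vtop C) (vtop Ug) \<theta>"
  proof (rule coords_continuous_into[OF co tsU])
    fix j assume j: "j \<in> J"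
    show "continuous_map (vtop C) euclidean (\<lambda>\<phi>. f (\<theta> \<phi>) j)"
      using continuous_map_compose[OF pr[OF N[OF j]] \<psi>(1)[OF j]] f\<theta>[OF j] by (simp add: o_def)
  qed (rule \<theta>U)
  have \<theta>\<omega>: "\<theta> (\<omega> u) = u" if "u \<in> vcar Ug" for u
    by (rule coords_eqI[OF co tsU \<theta>U that]) (use f\<theta> \<psi>(2) N that in \<open>simp add: om\<close>)
  \<comment> \<open>A basic open set constrains finitely many components, all of them determined by
    the component at a common lower bound \<open>K\<close>; there \<open>Umap_proj_dense\<close>
    applies.\<close>
  have dense: "\<phi> \<in> vtop C closure_of (\<omega> ` vcar Ug)" if \<phi>: "\<phi> \<in> vcar C" for \<phi>
    unfolding in_closure_of
  proof (intro conjI allI impI)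
    fix T assume T: "\<phi> \<in> T \<and> openin (vtop C) T"
    then obtain T' where T': "openin (product_topology (\<lambda>I. vtop (UQ I)) (Ideals g)) T'" "T = T' \<inter> vcar C"
      unfolding lim(5) openin_subtopology by blast
    have "\<phi> \<in> T'" using T T' by blast
    from bspec[OF iffD1[OF openin_product_topology_alt T'(1)] this]
    obtain B where B: "finite {I \<in> Ideals g. B I \<noteq> topspace (vtop (UQ I))}" "\<forall>I\<in>Ideals g. openin (vtop (UQ I)) (B I)"
      "\<phi> \<in> Pi\<^sub>E (Ideals g) B" "Pi\<^sub>E (Ideals g) B \<subseteq> T'"
      by (elim exE conjE)
    let ?F = "{I \<in> Ideals g. B I \<noteq> topspace (vtop (UQ I))}"
    obtain K where K: "K \<in> Ideals g" "\<And>I. I \<in> ?F \<Longrightarrow> K \<subseteq> I"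
      using Ideals_finite_lower_bound[OF L B(1)] by blast
    \<comment> \<open>The constraints pulled back to level \<open>K\<close>. The final intersection
      with the whole space covers the case of no constraints, where the indexed intersection is
      \<open>UNIV\<close>.\<close>
    define S where "S = (\<Inter>I\<in>?F. {v \<in> topspace (vtop (UQ K)). UP I K v \<in> B I}) \<inter> topspace (vtop (UQ K))"
    have "openin (vtop (UQ K)) {v \<in> topspace (vtop (UQ K)). UP I K v \<in> B I}" if "I \<in> ?F" for I
      using alg_homD(6)[OF UP(1)[OF _ K(1) K(2)[OF that]]] B(2) that
      by (intro openin_continuous_map_preimage) auto
    then have S: "openin (vtop (UQ K)) S"
      unfolding S_def by (rule openin_INT[OF B(1)])
    have \<phi>K: "\<phi> K \<in> vcar (UQ K)" "\<And>I. I \<in> ?F \<Longrightarrow> UP I K (\<phi> K) = \<phi> I"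
      using \<phi> K by (auto simp: lim(1) dest: PiE_mem)
    have "\<phi> K \<in> S"
      using \<phi>K B(3) wc_alg_topspace[OF wcQ[OF K(1)]] by (auto simp: S_def dest: PiE_mem)
    from Umap_proj_dense[OF L W K(1) WQ[OF K(1)] S this]
    obtain u where u: "u \<in> vcar Ug" "P K u \<in> S" by (auto simp: P_def)
    have "P I u \<in> B I" if "I \<in> Ideals g" for I
    proof (cases "I \<in> ?F")
      case True
      then have "UP I K (P K u) \<in> B I" using u(2) by (simp add: S_def)
      then show ?thesis using UPP[OF that K(1) K(2)[OF True] u(1)] by simp
    next
      case False
      then have "B I = vcar (UQ I)" using that wc_alg_topspace[OF wcQ[OF that]] by simp
      then show ?thesis using alg_homD(1)[OF P(1)[OF that] u(1)] by simp
    qed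
    then have "\<omega> u \<in> Pi\<^sub>E (Ideals g) B" by (simp add: om)
    then have "\<omega> u \<in> T" using B(4) T'(2) omC[OF u(1)] by blast
    then show "\<exists>y. y \<in> \<omega> ` vcar Ug \<and> y \<in> T" using u(1) by blast
  qed (use \<phi> tsC in simp)
  have \<omega>\<theta>: "\<omega> (\<theta> \<phi>) = \<phi>" if \<phi>: "\<phi> \<in> vcar C" for \<phi>
  proof (rule extensionalityI[of _ "Ideals g"])
    show "\<omega> (\<theta> \<phi>) \<in> extensional (Ideals g)" by (simp add: om)
    show "\<phi> \<in> extensional (Ideals g)" using \<phi> by (auto simp: lim(1) PiE_def)
    fix I assume I: "I \<in> Ideals g"
    have "P I (\<theta> \<phi>) = \<phi> I"
    \<comment> \<open>Both sides are continuous in the point of the limit and agree on the dense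
      image of \<omega>, where \<theta> is already known to invert \<omega>.\<close>
    proof (rule forall_in_closure_of_eq[OF dense[OF \<phi>] wc_alg_Hausdorff[OF wcQ[OF I]]])
      show "continuous_map (vtop C) (vtop (UQ I)) (\<lambda>\<phi>. P I (\<theta> \<phi>))"
        using continuous_map_compose[OF \<theta>_cont alg_homD(6)[OF P(1)[OF I]]] by (simp add: o_def)
      show "continuous_map (vtop C) (vtop (UQ I)) (\<lambda>\<phi>. \<phi> I)" using pr[OF I] .
      show "P I (\<theta> x) = x I" if "x \<in> \<omega> ` vcar Ug" for x using that \<theta>\<omega> I by (auto simp: om)
    qed
    then show "\<omega> (\<theta> \<phi>) I = \<phi> I" using I by (simp add: om)
  qed
  \<comment> \<open>Constant functions embed the type of \<open>Ug\<close> into that of the limit,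
    which supplies an index set for a chart there.\<close>
  have "inj (\<lambda>x. \<lambda>_ :: 'a set. x :: 'u)" by (auto simp: inj_def dest: fun_cong)
  note tr = wc_alg_transport[OF wcU hom zero tsC \<theta>_cont \<theta>\<omega> \<omega>\<theta> this]
  show ?thesis
  proof (intro conjI ballI impI)
    show "\<exists>K\<in>Ideals g. K \<subseteq> I \<and> K \<subseteq> J" if "I \<in> Ideals g" "J \<in> Ideals g" for I J
      using Ideals_Int[OF L that] by blast
    show "wc_alg (lim_alg (Ideals g) (\<subseteq>) UQ UP)" using tr(1) unfolding C_def .
    show "alg_iso Ug (lim_alg (Ideals g) (\<subseteq>) UQ UP) \<omega>" using tr(2) unfolding C_def .
  qed (use UP(1) id comp in simp_all)
qed

end
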